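(* Let $\mathbb{T}$ be a time scale with $\sup\mathbb{T}=\infty$, $t_0\in\mathbb{T}$, let $A:[t_0,\infty)_{\mathbb{T}}\to[0,\infty)$ and $\alpha:[t_0,\infty)_{\mathbb{T}}\to\mathbb{T}$ be rd-continuous with $\alpha(t)\le t$ for all $t\in[t_0,\infty)_{\mathbb T}$ and $\lim_{t\to\infty}\alpha(t)=\infty$, and consider the delay dynamic equation $$x^{\Delta}(t)+A(t)x(\alpha(t))=0,\qquad t\in[t_0,\infty)_{\mathbb{T}}. \quad (E)$$ Assume $$\sup_{s\in[t_0,\infty)_{\mathbb{T}}}\int_s^{\alpha_{-1}(s)}A(\eta)\,\Delta\eta<\infty\qquad\text{and}\qquad \sup_{s\in[t_0,\infty)_{\mathbb{T}}}\{\alpha_{-1}(s)-s\}<\infty .$$ Then the following statements are equivalent: (i) the trivial solution of (E) is uniformly exponentially stable; (ii) there exist $M_0,\lambda_0>0$ such that $|\mathcal{X}(t,s)|\le M_0\,\mathrm{e}_{\ominus\lambda_0}(t,s)$ for all $t,s\in\mathbb{T}$ with $t\ge s\ge t_0$, where $\mathcal{X}$ is the fundamental solution of (E).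
   Context: Time scales: a time scale $\mathbb{T}$ is a nonempty closed subset of $\mathbb{R}$; an interval with subscript $\mathbb{T}$ means its intersection with $\mathbb{T}$. $\sigma(t)=\inf(t,\infty)_{\mathbb{T}}$, $\mu(t)=\sigma(t)-t$; $t$ is right-dense if $\mu(t)=0$, right-scattered otherwise. $f^{\Delta}(t)$ is the $\Delta$-derivative: for every $\varepsilon>0$ there is a neighbourhood $U$ of $t$ in $\mathbb T$ with $|f(\sigma(t))-f(r)-f^{\Delta}(t)(\sigma(t)-r)|\le\varepsilon|\sigma(t)-r|$ for $r\in U$. A function is rd-continuous if it is continuous at right-dense points and has finite left limits at left-dense points. $\int_s^t f(\eta)\Delta\eta$ is the $\Delta$-integral, i.e. $\int_{[s,t)\cap\mathbb{T}}f\,d\eta+\sum_{\eta\in[s,t)_{\mathbb{T}},\ \mu(\eta)>0}\mu(\eta)f(\eta)$ for $s\le t$. For $f$ rd-continuous with $1+\mu f>0$, $\mathrm{e}_f(t,s)=\exp\{\int_s^t\xi_{\mu(\eta)}(f(\eta))\Delta\eta\}$ with $\xi_0(z)=z$, $\xi_h(z)=\frac1h\ln(1+hz)$ for $h>0$ (equivalently, $\mathrm{e}_f(\cdot,s)$ solves $x^\Delta=fx$, $x(s)=1$); $\ominus f:=-f/(1+\mu f)$, so $\mathrm{e}_{\ominus f}=1/\mathrm{e}_f$. Delay functions: $\alpha_*(t):=\inf\{\alpha(\eta):\eta\in[t,\infty)_{\mathbb{T}}\}$ and $\alpha_{-1}(t):=\sup\{\eta\in[t_0,\infty)_{\mathbb{T}}:\alpha_*(\eta)\le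 t\}$ for $t\in[t_0,\infty)_{\mathbb T}$. Initial value problem: for $s\in[t_0,\infty)_{\mathbb{T}}$, $x_0\in\mathbb{R}$ and bounded rd-continuous $\varphi:[\alpha_*(s),s)_{\mathbb{T}}\to\mathbb{R}$, the solution of (E) with data $(s,x_0,\varphi)$ is the function $x:[\alpha_*(s),\infty)_{\mathbb{T}}\to\mathbb{R}$ with $x=\varphi$ on $[\alpha_*(s),s)_{\mathbb{T}}$, $x(s)=x_0$, satisfying (E) on $[s,\infty)_{\mathbb{T}}$, understood as $x(t)=x_0-\int_s^tA(\eta)x(\alpha(\eta))\Delta\eta$ for $t\in[s,\infty)_{\mathbb{T}}$. The fundamental solution $\mathcal{X}(\cdot,s)$ is the solution with $x_0=1$, $\varphi\equiv0$. Uniform exponential stability of the trivial solution: there are $M,\lambda>0$ such that for every $s\in[t_0,\infty)_{\mathbb{T}}$, every solution $x$ with data $(s,x_0,\varphi)$ satisfies $|x(t)|\le M\,\mathrm{e}_{\ominus\lambda}(t,s)\big(|x_0|+\sup_{\eta\in[\alpha_*(s),s)_{\mathbb{T}}}|\varphi(\eta)|\big)$ for all $t\in[s,\infty)_{\mathbb{T}}$ (supremum over the empty set is $0$). *)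

theory Defs
  imports "HOL-Analysis.Analysis"
begin

definition time_scale :: "real set \<Rightarrow> bool" where
  "time_scale T \<longleftrightarrow> T \<noteq> {} \<and> closed T"

definition fwd_jump :: "real set \<Rightarrow> real \<Rightarrow> real" where
  "fwd_jump T t = Inf (T \<inter> {t<..})"

definition bwd_jump :: "real set \<Rightarrow> real \<Rightarrow> real" where
  "bwd_jump T t = Sup (T \<inter> {..<t})"

definition graininess :: "real set \<Rightarrow> real \<Rightarrow> real" where
  "graininess T t = fwd_jump T t - t"

definition right_dense :: "real set \<Rightarrow> real \<Rightarrow> bool" where
  "right_dense T t \<longleftrightarrow> graininess T t = 0"

(* The minimum of T, if there is one, does not count as left-dense. *)
definition left_dense :: "real set \<Rightarrow> real \<Rightarrow> bool" where
  "left_dense T t \<longleftrightarrow> T \<inter> {..<t} \<noteq> {} \<and> bwd_jump T t = t"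

(* Rd-continuity of f : D \<rightarrow> \<real>, where D is an interval of T. Density is meant in T, limits are
   taken within D; the left limit is vacuous at a left endpoint of D. *)
definition rd_continuous_on :: "real set \<Rightarrow> real set \<Rightarrow> (real \<Rightarrow> real) \<Rightarrow> bool" where
  "rd_continuous_on T D f \<longleftrightarrow>
     (\<forall>t\<in>D. (right_dense T t \<longrightarrow> continuous (at t within D) f) \<and>
            (left_dense T t \<longrightarrow> (\<exists>l. (f \<longlongrightarrow> l) (at t within (D \<inter> {..<t})))))"

definition scattered_points :: "real set \<Rightarrow> real \<Rightarrow> real \<Rightarrow> real set" where
  "scattered_points T s t = {\<eta> \<in> T \<inter> {s..<t}. graininess T \<eta> > 0}"

definition delta_integrable :: "real set \<Rightarrow> (real \<Rightarrow> real) \<Rightarrow> real \<Rightarrow> real \<Rightarrow> bool" where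
  "delta_integrable T f s t \<longleftrightarrow>
     set_integrable lborel (T \<inter> {s..<t}) f \<and>
     (\<lambda>\<eta>. graininess T \<eta> * f \<eta>) summable_on scattered_points T s t"

(* The integral from s to t, only meant for s \<le> t. *)
definition delta_integral :: "real set \<Rightarrow> (real \<Rightarrow> real) \<Rightarrow> real \<Rightarrow> real \<Rightarrow> real" where
  "delta_integral T f s t =
     (LINT \<eta>:T \<inter> {s..<t}|lborel. f \<eta>) +
     (\<Sum>\<^sub>\<infinity>\<eta>\<in>scattered_points T s t. graininess T \<eta> * f \<eta>)"

definition cylinder_transform :: "real \<Rightarrow> real \<Rightarrow> real" where
  "cylinder_transform h z = (if h = 0 then z else ln (1 + h * z) / h)"

(* The exponential function e_f(t,s), for s \<le> t and 1 + \<mu> f > 0. *)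
definition delta_exp :: "real set \<Rightarrow> (real \<Rightarrow> real) \<Rightarrow> real \<Rightarrow> real \<Rightarrow> real" where
  "delta_exp T f t s =
     exp (delta_integral T (\<lambda>\<eta>. cylinder_transform (graininess T \<eta>) (f \<eta>)) s t)"

definition circle_minus :: "real set \<Rightarrow> (real \<Rightarrow> real) \<Rightarrow> real \<Rightarrow> real" where
  "circle_minus T f \<eta> = - f \<eta> / (1 + graininess T \<eta> * f \<eta>)"

definition delay_low :: "real set \<Rightarrow> (real \<Rightarrow> real) \<Rightarrow> real \<Rightarrow> real" where
  "delay_low T \<alpha> t = (INF \<eta>\<in>T \<inter> {t..}. \<alpha> \<eta>)"

definition delay_inv :: "real set \<Rightarrow> real \<Rightarrow> (real \<Rightarrow> real) \<Rightarrow> real \<Rightarrow> real" where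
  "delay_inv T t0 \<alpha> t = Sup {\<eta> \<in> T \<inter> {t0..}. delay_low T \<alpha> \<eta> \<le> t}"

definition initial_interval :: "real set \<Rightarrow> (real \<Rightarrow> real) \<Rightarrow> real \<Rightarrow> real set" where
  "initial_interval T \<alpha> s = T \<inter> {delay_low T \<alpha> s..<s}"

definition initial_function :: "real set \<Rightarrow> (real \<Rightarrow> real) \<Rightarrow> real \<Rightarrow> (real \<Rightarrow> real) \<Rightarrow> bool" where
  "initial_function T \<alpha> s \<phi> \<longleftrightarrow>
     bounded (\<phi> ` initial_interval T \<alpha> s) \<and>
     rd_continuous_on T (initial_interval T \<alpha> s) \<phi>"

(* x solves the delay equation with data (s, x0, \<phi>). Only the values of x at points of T not
   below delay_low T \<alpha> s matter. Integrability is required explicitly because the integral of a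
   non-integrable function is a junk value. *)
definition is_solution ::
  "real set \<Rightarrow> (real \<Rightarrow> real) \<Rightarrow> (real \<Rightarrow> real) \<Rightarrow> real \<Rightarrow> real \<Rightarrow> (real \<Rightarrow> real) \<Rightarrow> (real \<Rightarrow> real) \<Rightarrow> bool"
where
  "is_solution T A \<alpha> s x0 \<phi> x \<longleftrightarrow>
     (\<forall>t\<in>initial_interval T \<alpha> s. x t = \<phi> t) \<and> x s = x0 \<and>
     (\<forall>t\<in>T \<inter> {s..}. delta_integrable T (\<lambda>\<eta>. A \<eta> * x (\<alpha> \<eta>)) s t \<and>
        x t = x0 - delta_integral T (\<lambda>\<eta>. A \<eta> * x (\<alpha> \<eta>)) s t)"

(* The solution is a function on T \<inter> {delay_low T \<alpha> s..}; extensionality fixes the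
   irrelevant values outside this domain, so that the description can be definite. *)
definition fundamental_solution ::
  "real set \<Rightarrow> (real \<Rightarrow> real) \<Rightarrow> (real \<Rightarrow> real) \<Rightarrow> real \<Rightarrow> real \<Rightarrow> real" where
  "fundamental_solution T A \<alpha> t s =
     (THE x. x \<in> extensional (T \<inter> {delay_low T \<alpha> s..}) \<and>
             is_solution T A \<alpha> s 1 (\<lambda>_. 0) x) t"

definition initial_norm :: "real set \<Rightarrow> (real \<Rightarrow> real) \<Rightarrow> real \<Rightarrow> (real \<Rightarrow> real) \<Rightarrow> real" where
  "initial_norm T \<alpha> s \<phi> =
     (if initial_interval T \<alpha> s = {} then 0
      else (SUP \<eta>\<in>initial_interval T \<alpha> s. \<bar>\<phi> \<eta>\<bar>))"

definition uniformly_exponentially_stable ::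
  "real set \<Rightarrow> real \<Rightarrow> (real \<Rightarrow> real) \<Rightarrow> (real \<Rightarrow> real) \<Rightarrow> bool" where
  "uniformly_exponentially_stable T t0 A \<alpha> \<longleftrightarrow>
     (\<exists>M>0. \<exists>c>0. \<forall>s\<in>T \<inter> {t0..}. \<forall>x0 \<phi> x.
        initial_function T \<alpha> s \<phi> \<longrightarrow> is_solution T A \<alpha> s x0 \<phi> x \<longrightarrow>
        (\<forall>t\<in>T \<inter> {s..}.
           \<bar>x t\<bar> \<le> M * delta_exp T (circle_minus T (\<lambda>_. c)) t s
                     * (\<bar>x0\<bar> + initial_norm T \<alpha> s \<phi>)))"

end

theory Submission
  imports Defs
begin

text \<open>The map \<open>rho\<close> rounding a real number down to \<open>T\<close> turns every \<open>\<Delta>\<close>-integral into a Lebesgue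
  integral over an interval, so that the equation becomes a delay equation with the coefficient
  \<open>A \<circ> rho\<close> and the delay function \<open>\<alpha> \<circ> rho\<close>. It is solved by Picard iteration in an exponentially
  weighted norm. By variation of constants, a solution is bounded by the fundamental solution and by
  the forcing due to the initial function, which lasts until \<open>delay_inv T t0 \<alpha> s\<close>, possibly including
  this point. The mass at this point is not controlled by the hypotheses, but a bound of the
  fundamental solution controls both the mass and the graininess there.\<close>

section \<open>Set integrals\<close>

text \<open>The integral in the first hypothesis runs over [s, \<tau>) with \<tau> =
  \<alpha>_{-1}(s), but if \<alpha>(\<tau>) < s, the forcing lasts up to \<sigma>(\<tau>). Both
  quantities needed there come from following a fundamental solution across the single gap after
  \<tau>. Started at \<alpha>(\<tau>), it loses exactly the mass at \<tau>, since the delayed value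
  is 1. Started at \<tau>, it loses nothing and still has the value 1 at \<sigma>(\<tau>), so the
  assumed decay across the gap cannot be strong. An integral form of variation of constants would
  require regularity of the fundamental solution in its second argument and an interchange of
  integrals. A finite superposition of fundamental solutions requires neither, and a Gronwall
  estimate absorbs its error. Existence is proved for the fundamental solution only: its definite
  description has to denote something, whereas stability speaks of solutions that are given.\<close>

lemma set_integrable_bounded_Ico:
  fixes h :: "real \<Rightarrow> real"
  assumes "h \<in> borel_measurable borel" and "\<And>u. s \<le> u \<Longrightarrow> u < r \<Longrightarrow> \<bar>h u\<bar> \<le> C"
  shows "set_integrable lborel {s..<r} h"
proof -
  have "emeasure lborel {s..<r} < \<infinity>" by (cases "s \<le> r") auto
  then show ?thesis
    unfolding set_integrable_def using assms
    by (intro integrableI_bounded_set_indicator[where B = C]) auto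
qed

lemma set_integral_nonneg_real:
  "(\<And>u. u \<in> S \<Longrightarrow> 0 \<le> f u) \<Longrightarrow> 0 \<le> (LINT u:S|M. f u :: real)"
  unfolding set_lebesgue_integral_def by (intro integral_nonneg_AE) (auto simp: indicator_def)

lemma abs_set_integral_le:
  fixes f g :: "real \<Rightarrow> real"
  assumes "set_integrable M S f" "set_integrable M S g" "\<And>u. u \<in> S \<Longrightarrow> \<bar>f u\<bar> \<le> g u"
  shows "\<bar>LINT u:S|M. f u\<bar> \<le> (LINT u:S|M. g u)"
proof -
  have "norm (LINT u:S|M. f u) \<le> (LINT u:S|M. g u)"
    unfolding set_lebesgue_integral_def
  proof (rule Bochner_Integration.integral_norm_bound_integral)
    show "integrable M (\<lambda>x. indicator S x *\<^sub>R f x)" "integrable M (\<lambda>x. indicator S x *\<^sub>R g x)"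
      using assms(1,2) by (auto simp: set_integrable_def)
    show "norm (indicator S x *\<^sub>R f x) \<le> indicator S x *\<^sub>R g x" for x
      using assms(3)[of x] by (auto simp: indicator_def)
  qed
  then show ?thesis by simp
qed

lemma
  fixes f :: "'i \<Rightarrow> 'a \<Rightarrow> real"
  assumes "\<And>i. i \<in> I \<Longrightarrow> set_integrable M S (f i)"
  shows set_integrable_sum: "set_integrable M S (\<lambda>u. \<Sum>i\<in>I. f i u)"
    and set_integral_sum: "(LINT u:S|M. \<Sum>i\<in>I. f i u) = (\<Sum>i\<in>I. LINT u:S|M. f i u)"
  using assms by (simp_all add: set_integrable_def set_lebesgue_integral_def sum_distrib_left)

lemma set_integral_Ico_split:
  fixes f :: "real \<Rightarrow> real"
  assumes "set_integrable lborel {s..<t} f" "s \<le> r" "r \<le> t"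
  shows "(LINT u:{s..<t}|lborel. f u) = (LINT u:{s..<r}|lborel. f u) + (LINT u:{r..<t}|lborel. f u)"
proof -
  have "{s..<t} = {s..<r} \<union> {r..<t}" using assms by auto
  moreover have "set_integrable lborel {s..<r} f" "set_integrable lborel {r..<t} f"
    using assms by (auto intro: set_integrable_subset)
  ultimately show ?thesis by (simp add: set_integral_Un)
qed

text \<open>The rate \<open>2 * B\<close> is twice the bound \<open>B\<close> of the coefficient, so
  integrating \<open>B\<close> times the weight returns at most half the weight. This factor 1/2
  drives both the Gronwall estimate and the Picard iteration.\<close>

lemma exp_set_integral_le:
  fixes B N :: real
  assumes "B > 0" "N \<ge> 0" "s \<le> r"
  shows "set_integrable lborel {s..<r} (\<lambda>u. B * (N * exp (2 * B * (u - s))))"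
    and "(LINT u:{s..<r}|lborel. B * (N * exp (2 * B * (u - s)))) \<le> N / 2 * exp (2 * B * (r - s))"
proof -
  let ?f = "\<lambda>u. B * (N * exp (2 * B * (u - s)))" and ?F = "\<lambda>u. N / 2 * exp (2 * B * (u - s))"
  have F: "(?F has_real_derivative ?f x) (at x)" for x
    by (auto intro!: derivative_eq_intros)
  have cont: "continuous_on {s..r} ?f" by (intro continuous_intros)
  have "has_bochner_integral lborel (\<lambda>x. ?f x * indicator {s..r} x) (?F r - ?F s)"
    by (rule has_bochner_integral_FTC_Icc_real) (use F cont assms in \<open>auto intro!: continuous_intros\<close>)
  then have I: "integrable lborel (\<lambda>x. indicator {s..r} x *\<^sub>R ?f x)"
    "(LINT x|lborel. indicator {s..r} x *\<^sub>R ?f x) = ?F r - ?F s"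
    by (auto simp: has_bochner_integral_iff mult.commute)
  then have Icc: "set_integrable lborel {s..r} ?f" by (simp add: set_integrable_def)
  then show int: "set_integrable lborel {s..<r} ?f" by (rule set_integrable_subset) auto
  have "(LINT u:{s..<r}|lborel. ?f u) \<le> (LINT u:{s..r}|lborel. ?f u)"
    unfolding set_lebesgue_integral_def using int Icc assms
    by (intro integral_mono) (auto simp: set_integrable_def indicator_def)
  also have "\<dots> \<le> ?F r" 
    unfolding set_lebesgue_integral_def I(2) using assms by simp
  finally show "(LINT u:{s..<r}|lborel. ?f u) \<le> ?F r" .
qed

section \<open>Time scales\<close>

text \<open>The gaps following right-scattered points are disjoint nonempty open intervals, and the
  line contains only countably many of those.\<close>

lemma countable_right_scattered:
  fixes T :: "real set"
  shows "countable {\<eta> \<in> T. graininess T \<eta> > 0}"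
proof -
  let ?R = "{\<eta> \<in> T. graininess T \<eta> > 0}"
  let ?I = "\<lambda>\<eta>. {\<eta><..<fwd_jump T \<eta>}"
  have le: "fwd_jump T x \<le> y" if "x \<in> T" "y \<in> T" "x < y" for x y
    unfolding fwd_jump_def using that by (auto intro!: cInf_lower bdd_belowI[of _ x])
  have disj: "disjnt (?I x) (?I y)" if "x \<in> ?R" "y \<in> ?R" "x < y" for x y
    using le[of x y] that by (auto simp: disjnt_def)
  have inj: "inj_on ?I ?R"
  proof (rule inj_onI, rule ccontr)
    fix x y assume *: "x \<in> ?R" "y \<in> ?R" "?I x = ?I y" "x \<noteq> y"
    have "disjnt (?I x) (?I y)"
      using disj[of x y] disj[of y x] * by (cases x y rule: linorder_cases) auto
    with * have "?I x = {}" by (auto simp: disjnt_def)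
    with * show False by (auto simp: graininess_def)
  qed
  have "pairwise disjnt (?I ` ?R)"
  proof (rule pairwiseI)
    fix I J assume *: "I \<in> ?I ` ?R" "J \<in> ?I ` ?R" "I \<noteq> J"
    then obtain x y where xy: "I = ?I x" "J = ?I y" "x \<in> ?R" "y \<in> ?R" by blast
    then have "x \<noteq> y" using * by auto
    then show "disjnt I J"
      using disj[of x y] disj[of y x] xy by (cases x y rule: linorder_cases) (auto simp: disjnt_sym)
  qed
  then have "countable (?I ` ?R)"
    by (intro countable_disjoint_open_subsets) auto
  then show ?thesis using inj by (rule countable_image_inj_on)
qed

locale unbounded_time_scale =
  fixes T :: "real set" and t0 :: real
  assumes closed_T: "closed T" and unbounded: "\<not> bdd_above T" and t0: "t0 \<in> T"
begin

text \<open>The maximum only keeps the values in \<^term>\<open>T \<inter> {t0..}\<close> for arguments below \<^term>\<open>t0\<close>.\<close>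

definition rho :: "real \<Rightarrow> real" where
  "rho u = Sup (T \<inter> {..max t0 u})"

lemma rho_in: "rho u \<in> T"
  unfolding rho_def by (rule closed_subset_contains_Sup[OF closed_T]) (use t0 in \<open>auto intro!: exI[of _ t0]\<close>)

lemma rho_upper: "\<eta> \<in> T \<Longrightarrow> \<eta> \<le> max t0 u \<Longrightarrow> \<eta> \<le> rho u"
  unfolding rho_def by (rule cSup_upper) auto

lemma rho_le_max: "rho u \<le> max t0 u"
  unfolding rho_def by (rule cSup_least) (use t0 in auto)

lemma rho_ge_t0: "t0 \<le> rho u"
  using rho_upper[OF t0] by auto

lemma rho_le: "t0 \<le> u \<Longrightarrow> rho u \<le> u"
  using rho_le_max[of u] by auto

lemma rho_ge: "\<eta> \<in> T \<Longrightarrow> \<eta> \<le> u \<Longrightarrow> \<eta> \<le> rho u"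
  by (rule rho_upper) auto

lemma rho_eq: "u \<in> T \<Longrightarrow> t0 \<le> u \<Longrightarrow> rho u = u"
  by (simp add: antisym rho_ge rho_le)

lemma mono_rho: "mono rho"
proof (rule monoI)
  fix u v :: real assume "u \<le> v"
  then show "rho u \<le> rho v"
    using rho_le_max[of u] by (intro rho_upper rho_in) auto
qed

lemma borel_measurable_rho [measurable]: "rho \<in> borel_measurable borel"
  by (rule borel_measurable_mono[OF mono_rho])

lemma ex_above: "\<exists>\<eta>\<in>T. \<eta> > t"
  using unbounded by (meson bdd_above.I not_le)

lemma fwd_jump_in: "fwd_jump T t \<in> T"
  unfolding fwd_jump_def
proof (rule closed_subset_contains_Inf[OF closed_T])
  show "bdd_below (T \<inter> {t<..})" by (rule bdd_belowI[of _ t]) auto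
qed (use ex_above[of t] in auto)

lemma fwd_jump_ge: "t \<le> fwd_jump T t"
  unfolding fwd_jump_def by (rule cInf_greatest) (use ex_above[of t] in auto)

lemma fwd_jump_le: "\<eta> \<in> T \<Longrightarrow> t < \<eta> \<Longrightarrow> fwd_jump T t \<le> \<eta>"
  unfolding fwd_jump_def by (rule cInf_lower) (auto intro: bdd_belowI[of _ t])

lemma mono_fwd_jump: "mono (fwd_jump T)"
proof (rule monoI)
  fix s t :: real assume "s \<le> t"
  then show "fwd_jump T s \<le> fwd_jump T t"
    unfolding fwd_jump_def[of T t]
    by (intro cInf_greatest) (use ex_above[of t] fwd_jump_le in auto)
qed

lemma graininess_nonneg: "0 \<le> graininess T t"
  using fwd_jump_ge by (simp add: graininess_def)

lemma borel_measurable_graininess [measurable]: "graininess T \<in> borel_measurable borel"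
proof -
  note borel_measurable_mono[OF mono_fwd_jump, measurable]
  show ?thesis unfolding graininess_def[abs_def] by measurable
qed

lemma borel_T [measurable]: "T \<in> sets borel"
  using closed_T by simp

section \<open>Rounding down to \<open>T\<close>: \<Delta>-integrals as Lebesgue integrals\<close>

lemma rho_gap:
  assumes "\<eta> \<in> T" "t0 \<le> \<eta>" "\<eta> \<le> u" "u < fwd_jump T \<eta>"
  shows "rho u = \<eta>"
proof (rule antisym)
  show "\<eta> \<le> rho u" using assms rho_ge by blast
  show "rho u \<le> \<eta>"
    using fwd_jump_le[OF rho_in, of \<eta> u] rho_le[of u] assms by fastforce
qed

text \<open>If the jump of \<open>rho u\<close> did not pass \<open>u\<close>, maximality of
  \<open>rho u\<close> would force it to equal \<open>rho u\<close>. Points of \<open>T\<close>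
  would then accumulate at \<open>rho u\<close> from the right, and one of them would lie between
  \<open>rho u\<close> and \<open>u\<close>.\<close>

lemma less_fwd_jump_rho:
  assumes "t0 \<le> u" "u \<notin> T"
  shows "rho u < u" "u < fwd_jump T (rho u)"
proof -
  show "rho u < u" using assms rho_le[of u] rho_in[of u] by (cases "rho u = u") auto
  show "u < fwd_jump T (rho u)"
  proof (rule ccontr)
    assume "\<not> u < fwd_jump T (rho u)"
    then have eq: "fwd_jump T (rho u) = rho u"
      using rho_ge[OF fwd_jump_in, of "rho u" u] fwd_jump_ge[of "rho u"] by auto
    obtain \<eta> where "\<eta> \<in> T" "rho u < \<eta>" "\<eta> < u"
    proof (rule ccontr)
      assume "\<not> thesis"
      with that have *: "\<not> \<eta> < u" if "\<eta> \<in> T" "rho u < \<eta>" for \<eta> using that by blast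
      have "u \<le> fwd_jump T (rho u)" unfolding fwd_jump_def
        by (rule cInf_greatest) (use ex_above[of "rho u"] * in force)+
      with eq \<open>rho u < u\<close> show False by simp
    qed
    then show False using rho_ge[of \<eta> u] by auto
  qed
qed

text \<open>The fibre of \<open>rho\<close> in \<open>G\<close> over a scattered point is the open
  gap after it, which is not cut off at \<open>t\<close> because \<open>t\<close> lies in
  \<open>T\<close>. So the image of Lebesgue measure on \<open>G\<close> under \<open>rho\<close> is
  the counting measure on \<open>R\<close> with density \<open>graininess T\<close>, and both claims
  are a change of variables.\<close>

lemma gaps_integral:
  fixes f :: "real \<Rightarrow> real"
  assumes s: "t0 \<le> s" "s \<in> T" and t: "t \<in> T"
  defines "G \<equiv> {s..<t} - T" and "R \<equiv> scattered_points T s t"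
  shows "set_integrable lborel G (\<lambda>u. f (rho u)) \<longleftrightarrow> (\<lambda>\<eta>. graininess T \<eta> * f \<eta>) summable_on R"
    and "set_integrable lborel G (\<lambda>u. f (rho u)) \<Longrightarrow>
      (LINT u:G|lborel. f (rho u)) = (\<Sum>\<^sub>\<infinity>\<eta>\<in>R. graininess T \<eta> * f \<eta>)"
proof -
  let ?M = "restrict_space lborel G"
  have [measurable]: "G \<in> sets borel" by (simp add: G_def)
  have R: "countable R"
    by (rule countable_subset[OF _ countable_right_scattered[of T]]) (auto simp: R_def scattered_points_def)
  have pre: "rho -` {\<eta>} \<inter> G = {\<eta><..<fwd_jump T \<eta>}" if "\<eta> \<in> R" for \<eta>
  proof (intro equalityI subsetI)
    fix u assume "u \<in> rho -` {\<eta>} \<inter> G"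
    then show "u \<in> {\<eta><..<fwd_jump T \<eta>}"
      using less_fwd_jump_rho[of u] s by (auto simp: G_def)
  next
    fix u assume u: "u \<in> {\<eta><..<fwd_jump T \<eta>}"
    from that have \<eta>: "\<eta> \<in> T" "s \<le> \<eta>" "\<eta> < t" by (auto simp: R_def scattered_points_def)
    have "rho u = \<eta>" using \<eta> u s by (intro rho_gap) auto
    moreover have "fwd_jump T \<eta> \<le> t" using \<eta> t fwd_jump_le by blast
    moreover have "u \<notin> T" using u fwd_jump_le[of u \<eta>] by auto
    ultimately show "u \<in> rho -` {\<eta>} \<inter> G" using u \<eta> by (auto simp: G_def)
  qed
  have rhoG: "rho \<in> G \<rightarrow> R"
  proof
    fix u assume "u \<in> G"
    then have u: "s \<le> u" "u < t" "u \<notin> T" by (auto simp: G_def)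
    show "rho u \<in> R"
      using less_fwd_jump_rho[of u] u s rho_in[of u] rho_ge[of s u]
      by (auto simp: R_def scattered_points_def graininess_def)
  qed
  have m: "rho \<in> measurable ?M (count_space R)"
    unfolding measurable_count_space_eq_countable[OF R]
  proof (intro conjI ballI)
    fix \<eta> assume "\<eta> \<in> R"
    then have eq: "rho -` {\<eta>} \<inter> space ?M = G \<inter> {\<eta><..<fwd_jump T \<eta>}"
      using pre[of \<eta>] by (auto simp: space_restrict_space)
    show "rho -` {\<eta>} \<inter> space ?M \<in> sets ?M"
      unfolding eq sets_restrict_space by (rule imageI) simp
  qed (use rhoG in \<open>auto simp: space_restrict_space\<close>)
  have eq: "distr ?M (count_space R) rho = density (count_space R) (\<lambda>\<eta>. ennreal (graininess T \<eta>))"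
  proof (rule measure_eqI_countable[OF _ _ R])
    fix \<eta> assume \<eta>: "\<eta> \<in> R"
    have "emeasure (distr ?M (count_space R) rho) {\<eta>} = emeasure ?M (rho -` {\<eta>} \<inter> G)"
      using \<eta> by (simp add: emeasure_distr[OF m] space_restrict_space)
    also have "\<dots> = emeasure lborel {\<eta><..<fwd_jump T \<eta>}"
      using pre[OF \<eta>] by (subst emeasure_restrict_space) auto
    also have "\<dots> = ennreal (graininess T \<eta>)"
      using fwd_jump_ge by (simp add: graininess_def)
    also have "\<dots> = emeasure (density (count_space R) (\<lambda>\<eta>. ennreal (graininess T \<eta>))) {\<eta>}"
      using \<eta> by (subst emeasure_density) (auto simp: nn_integral_count_space_indicator)
    finally show "emeasure (distr ?M (count_space R) rho) {\<eta>} =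
      emeasure (density (count_space R) (\<lambda>\<eta>. ennreal (graininess T \<eta>))) {\<eta>}" .
  qed auto
  have "set_integrable lborel G (\<lambda>u. f (rho u)) \<longleftrightarrow> integrable ?M (\<lambda>u. f (rho u))"
    by (simp add: integrable_restrict_space set_integrable_def)
  also have "\<dots> \<longleftrightarrow> integrable (distr ?M (count_space R) rho) f"
    by (subst integrable_distr_eq[OF m]) auto
  also have "\<dots> \<longleftrightarrow> integrable (count_space R) (\<lambda>\<eta>. graininess T \<eta> * f \<eta>)"
    unfolding eq by (subst integrable_density) (auto simp: graininess_nonneg)
  finally have int: "set_integrable lborel G (\<lambda>u. f (rho u)) \<longleftrightarrow>
    Infinite_Set_Sum.abs_summable_on (\<lambda>\<eta>. graininess T \<eta> * f \<eta>) R"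
    unfolding Infinite_Set_Sum.abs_summable_on_def .
  \<comment> \<open>Integrability over a counting measure is absolute summability, which for real
    terms coincides with unconditional summability.\<close>
  then show "set_integrable lborel G (\<lambda>u. f (rho u)) \<longleftrightarrow> (\<lambda>\<eta>. graininess T \<eta> * f \<eta>) summable_on R"
    by (subst summable_on_iff_abs_summable_on_real) (simp only: abs_summable_equivalent)
  assume "set_integrable lborel G (\<lambda>u. f (rho u))"
  then have sum: "Infinite_Set_Sum.abs_summable_on (\<lambda>\<eta>. graininess T \<eta> * f \<eta>) R" using int by simp
  have "(LINT u:G|lborel. f (rho u)) = (LINT u|?M. f (rho u))"
    by (simp add: integral_restrict_space set_lebesgue_integral_def)
  also have "\<dots> = (LINT \<eta>|distr ?M (count_space R) rho. f \<eta>)"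
    by (subst integral_distr[OF m]) auto
  also have "\<dots> = (LINT \<eta>|count_space R. graininess T \<eta> * f \<eta>)"
    unfolding eq by (subst integral_density) (auto simp: graininess_nonneg)
  also have "\<dots> = (\<Sum>\<^sub>\<infinity>\<eta>\<in>R. graininess T \<eta> * f \<eta>)"
    using infsetsum_infsum[OF sum] by (simp add: infsetsum_def)
  finally show "(LINT u:G|lborel. f (rho u)) = (\<Sum>\<^sub>\<infinity>\<eta>\<in>R. graininess T \<eta> * f \<eta>)" .
qed

text \<open>\<open>[s,t)\<close> splits into its points in \<open>T\<close>, where
  \<open>rho\<close> is the identity, and the gaps, where \<open>gaps_integral\<close> produces the
  sum.\<close>

lemma
  fixes f :: "real \<Rightarrow> real"
  assumes s: "t0 \<le> s" "s \<in> T" and t: "t \<in> T"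
  shows delta_integrable_iff:
      "delta_integrable T f s t \<longleftrightarrow> set_integrable lborel {s..<t} (\<lambda>u. f (rho u))"
    and delta_integral_eq:
      "set_integrable lborel {s..<t} (\<lambda>u. f (rho u)) \<Longrightarrow>
        delta_integral T f s t = (LINT u:{s..<t}|lborel. f (rho u))"
proof -
  let ?g = "\<lambda>u. f (rho u)"
  have Un: "{s..<t} = (T \<inter> {s..<t}) \<union> ({s..<t} - T)" by auto
  have cong: "set_integrable lborel (T \<inter> {s..<t}) ?g \<longleftrightarrow> set_integrable lborel (T \<inter> {s..<t}) f"
    by (rule set_integrable_cong) (use s in \<open>auto simp: rho_eq\<close>)
  have sub: "set_integrable lborel (T \<inter> {s..<t}) ?g \<and> set_integrable lborel ({s..<t} - T) ?g"
    if "set_integrable lborel {s..<t} ?g"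
    using that by (auto intro: set_integrable_subset)
  moreover have "set_integrable lborel {s..<t} ?g"
    if "set_integrable lborel (T \<inter> {s..<t}) ?g \<and> set_integrable lborel ({s..<t} - T) ?g"
    using that set_integrable_Un[of lborel "T \<inter> {s..<t}" ?g "{s..<t} - T"] Un by simp
  ultimately show "delta_integrable T f s t \<longleftrightarrow> set_integrable lborel {s..<t} ?g"
    unfolding delta_integrable_def using gaps_integral(1)[OF s t, of f] cong by blast
  assume "set_integrable lborel {s..<t} ?g"
  with sub have int: "set_integrable lborel (T \<inter> {s..<t}) ?g" "set_integrable lborel ({s..<t} - T) ?g"
    by auto
  have "(LINT u:{s..<t}|lborel. ?g u) =
      (LINT u:T \<inter> {s..<t}|lborel. ?g u) + (LINT u:{s..<t} - T|lborel. ?g u)"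
    using set_integral_Un[OF _ int] Un by auto
  also have "(LINT u:T \<inter> {s..<t}|lborel. ?g u) = (LINT u:T \<inter> {s..<t}|lborel. f u)"
    by (rule set_lebesgue_integral_cong) (use s in \<open>auto simp: rho_eq\<close>)
  also have "(LINT u:{s..<t} - T|lborel. ?g u) =
      (\<Sum>\<^sub>\<infinity>\<eta>\<in>scattered_points T s t. graininess T \<eta> * f \<eta>)"
    by (rule gaps_integral(2)[OF s t int(2)])
  finally show "delta_integral T f s t = (LINT u:{s..<t}|lborel. ?g u)"
    by (simp add: delta_integral_def)
qed

section \<open>Rd-continuous functions: measurability and local boundedness\<close>

text \<open>Away from the countable set of right-scattered points \<open>f\<close> is continuous,
  and changing a function on a countable set preserves Borel measurability.\<close>

lemma borel_measurable_rd_continuous_rho: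
  assumes "rd_continuous_on T (T \<inter> {t0..}) f"
  shows "(\<lambda>u. f (rho u)) \<in> borel_measurable borel"
proof -
  let ?D = "T \<inter> {t0..}" and ?S = "{\<eta> \<in> T. graininess T \<eta> > 0}"
  have cS: "countable ?S" by (rule countable_right_scattered)
  have S: "?S \<in> sets borel" using cS by (rule sets.countable[rotated]) simp
  have "continuous_on (?D - ?S) f"
    unfolding continuous_on_eq_continuous_within
  proof
    fix t assume t: "t \<in> ?D - ?S"
    then have "right_dense T t" using graininess_nonneg[of t] by (auto simp: right_dense_def)
    then have "continuous (at t within ?D) f" using assms t by (auto simp: rd_continuous_on_def)
    then show "continuous (at t within ?D - ?S) f" by (rule continuous_within_subset) auto
  qed
  then have "(\<lambda>x. indicator (?D - ?S) x *\<^sub>R f x) \<in> borel_measurable borel"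
    using S by (intro borel_measurable_continuous_on_indicator) auto
  then have g: "(\<lambda>x. indicator ?D x *\<^sub>R f x) \<in> borel_measurable borel"
    by (rule measurable_discrete_difference[OF _ cS]) (auto simp: indicator_def)
  have "(\<lambda>u. f (rho u)) = (\<lambda>x. indicator ?D x *\<^sub>R f x) \<circ> rho"
    using rho_in rho_ge_t0 by (auto simp: fun_eq_iff)
  then show ?thesis using measurable_comp[OF borel_measurable_rho g] by simp
qed

text \<open>By compactness it suffices to bound \<open>f\<close> near each point, one side at a
  time. On a dense side the one-sided limit gives a bound; on the other sides a small punctured
  neighbourhood contains no point of the domain.\<close>

lemma bounded_rd_continuous:
  assumes "rd_continuous_on T (T \<inter> {t0..}) f"
  shows "bounded (f ` (T \<inter> {t0..b}))"
proof -
  let ?D = "T \<inter> {t0..}"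
  have loc: "\<exists>U. open U \<and> x \<in> U \<and> bounded (f ` (?D \<inter> U))" if x: "x \<in> ?D" for x
  proof -
    have near: "\<exists>d>0. bounded (f ` (S \<inter> ball x d - {x}))" if "(f \<longlongrightarrow> l) (at x within S)" for S l
    proof -
      have "\<forall>\<^sub>F y in at x within S. dist (f y) l < 1" using that by (rule tendstoD) simp
      then obtain d where d: "d > 0" "\<And>y. y \<in> S \<Longrightarrow> y \<noteq> x \<Longrightarrow> dist y x < d \<Longrightarrow> dist (f y) l < 1"
        by (auto simp: eventually_at)
      then have "f ` (S \<inter> ball x d - {x}) \<subseteq> ball l 1"
        using d(2) by (force simp: dist_commute)
      with d show ?thesis using bounded_ball bounded_subset by blast
    qed
    have left: "\<exists>d>0. bounded (f ` (?D \<inter> {..<x} \<inter> ball x d - {x}))"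
    proof (cases "left_dense T x")
      case True
      then obtain l where "(f \<longlongrightarrow> l) (at x within (?D \<inter> {..<x}))"
        using assms x by (auto simp: rd_continuous_on_def)
      then show ?thesis using near by blast
    next
      case False
      show ?thesis
      proof (cases "T \<inter> {..<x} = {}")
        case True
        then have "?D \<inter> {..<x} \<inter> ball x 1 - {x} = {}" by auto
        then show ?thesis by (metis bounded_empty image_empty zero_less_one)
      next
        case ne: False
        have "Sup (T \<inter> {..<x}) \<le> x" using ne by (intro cSup_least) auto
        with False ne have "Sup (T \<inter> {..<x}) < x" by (auto simp: left_dense_def bwd_jump_def)
        moreover have "y \<le> Sup (T \<inter> {..<x})" if "y \<in> T" "y < x" for y
          using that by (intro cSup_upper) (auto intro: bdd_aboveI[of _ x])
        ultimately have "?D \<inter> {..<x} \<inter> ball x (x - Sup (T \<inter> {..<x})) - {x} = {}"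
          by (force simp: dist_real_def)
        then show ?thesis using \<open>Sup (T \<inter> {..<x}) < x\<close>
          by (metis bounded_empty image_empty diff_gt_0_iff_gt)
      qed
    qed
    have right: "\<exists>d>0. bounded (f ` (?D \<inter> {x<..} \<inter> ball x d - {x}))"
    proof (cases "right_dense T x")
      case True
      then have "continuous (at x within ?D) f" using assms x by (auto simp: rd_continuous_on_def)
      then have "(f \<longlongrightarrow> f x) (at x within ?D)" by (simp add: continuous_within)
      then have "(f \<longlongrightarrow> f x) (at x within (?D \<inter> {x<..}))" by (rule tendsto_within_subset) auto
      then show ?thesis using near by blast
    next
      case False
      then have "x < fwd_jump T x" using fwd_jump_ge[of x] by (auto simp: right_dense_def graininess_def)
      moreover have "?D \<inter> {x<..} \<inter> ball x (fwd_jump T x - x) - {x} = {}"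
        using fwd_jump_le[of _ x] by (force simp: dist_real_def)
      ultimately show ?thesis by (metis bounded_empty image_empty diff_gt_0_iff_gt)
    qed
    from left right obtain d e where de: "d > 0" "e > 0"
      "bounded (f ` (?D \<inter> {..<x} \<inter> ball x d - {x}))" "bounded (f ` (?D \<inter> {x<..} \<inter> ball x e - {x}))"
      by blast
    have "f ` (?D \<inter> ball x (min d e)) \<subseteq> insert (f x)
        (f ` (?D \<inter> {..<x} \<inter> ball x d - {x}) \<union> f ` (?D \<inter> {x<..} \<inter> ball x e - {x}))"
      proof (rule image_subsetI)
      fix y assume y: "y \<in> ?D \<inter> ball x (min d e)"
      consider "y < x" | "y = x" | "y > x" by linarith
      then show "f y \<in> insert (f x)
          (f ` (?D \<inter> {..<x} \<inter> ball x d - {x}) \<union> f ` (?D \<inter> {x<..} \<inter> ball x e - {x}))"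
        by cases (use y in auto)
    qed
    then have "bounded (f ` (?D \<inter> ball x (min d e)))"
      using de by (meson bounded_Un bounded_insert bounded_subset)
    then show ?thesis using de by (intro exI[of _ "ball x (min d e)"]) auto
  qed
  have "compact (T \<inter> {t0..b})" by (intro closed_Int_compact closed_T) auto
  moreover have "\<forall>x\<in>T \<inter> {t0..b}. \<exists>U. open U \<and> x \<in> U \<and> bounded (f ` (?D \<inter> U))"
    using loc by auto
  then obtain U where U: "\<And>x. x \<in> T \<inter> {t0..b} \<Longrightarrow> open (U x) \<and> x \<in> U x \<and> bounded (f ` (?D \<inter> U x))"
    by metis
  moreover have "T \<inter> {t0..b} \<subseteq> (\<Union>x\<in>T \<inter> {t0..b}. U x)" using U by blast
  ultimately obtain C where C: "C \<subseteq> T \<inter> {t0..b}" "finite C" "T \<inter> {t0..b} \<subseteq> (\<Union>x\<in>C. U x)"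
    by (metis (no_types, lifting) compactE_image)
  have "bounded (\<Union>x\<in>C. f ` (?D \<inter> U x))" using C(1,2) U by (intro bounded_UN) blast+
  moreover have "f ` (T \<inter> {t0..b}) \<subseteq> (\<Union>x\<in>C. f ` (?D \<inter> U x))" using C by fastforce
  ultimately show ?thesis by (rule bounded_subset)
qed

section \<open>The exponential function of \<ominus>c\<close>

abbreviation decay :: "real \<Rightarrow> real \<Rightarrow> real \<Rightarrow> real" where
  "decay c \<equiv> delta_exp T (circle_minus T (\<lambda>_. c))"

text \<open>As 1 + \<mu>(\<ominus>c) = 1/(1 + \<mu>c), the exponent at a scattered point is -ln(1 +
  \<mu>c)/\<mu>, and ln(1 + y) \<le> y places it in [-c, 0]. Boundedness then yields integrability,
  so \<open>decay\<close> is a genuine exponential of an integral.\<close>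

lemma decay_exponent:
  fixes c :: real
  assumes c: "c > 0"
  defines "\<xi> \<equiv> \<lambda>\<eta>. cylinder_transform (graininess T \<eta>) (circle_minus T (\<lambda>_. c) \<eta>)"
  shows decay_exponent_bounds: "- c \<le> \<xi> \<eta>" "\<xi> \<eta> \<le> 0"
    and decay_exponent_integrable: "set_integrable lborel {s..<t} (\<lambda>u. \<xi> (rho u))"
    and decay_eq: "t0 \<le> s \<Longrightarrow> s \<in> T \<Longrightarrow> t \<in> T \<Longrightarrow> decay c t s = exp (LINT u:{s..<t}|lborel. \<xi> (rho u))"
proof -
  have bounds: "- c \<le> \<xi> \<eta>" "\<xi> \<eta> \<le> 0" for \<eta>
  proof -
    let ?\<mu> = "graininess T \<eta>"
    have \<mu>: "0 \<le> ?\<mu>" by (rule graininess_nonneg)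
    have "- c \<le> \<xi> \<eta> \<and> \<xi> \<eta> \<le> 0"
    proof (cases "?\<mu> = 0")
      case True
      then show ?thesis using c by (simp add: \<xi>_def cylinder_transform_def circle_minus_def)
    next
      case False
      then have pos: "0 < ?\<mu>" "0 < 1 + ?\<mu> * c" using \<mu> c by (auto intro: add_pos_pos)
      then have "1 + ?\<mu> * (- c / (1 + ?\<mu> * c)) = 1 / (1 + ?\<mu> * c)" by (simp add: field_simps)
      then have "\<xi> \<eta> = - ln (1 + ?\<mu> * c) / ?\<mu>"
        using pos by (simp add: \<xi>_def cylinder_transform_def circle_minus_def ln_div)
      moreover have "ln (1 + ?\<mu> * c) \<le> ?\<mu> * c" "0 \<le> ln (1 + ?\<mu> * c)"
        using pos c by (auto intro: ln_add_one_self_le_self)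
      ultimately have "ln (1 + ?\<mu> * c) / ?\<mu> \<le> c" "0 \<le> ln (1 + ?\<mu> * c) / ?\<mu>"
        using pos by (simp_all add: divide_le_eq mult.commute)
      then show ?thesis using \<open>\<xi> \<eta> = _\<close> by simp
    qed
    then show "- c \<le> \<xi> \<eta>" "\<xi> \<eta> \<le> 0" by auto
  qed
  then show "- c \<le> \<xi> \<eta>" "\<xi> \<eta> \<le> 0" by auto
  have [measurable]: "\<xi> \<in> borel_measurable borel"
    unfolding \<xi>_def cylinder_transform_def circle_minus_def by measurable
  show int: "set_integrable lborel {s..<t} (\<lambda>u. \<xi> (rho u))" for s t
  proof (rule set_integrable_bounded_Ico[where C = c])
    show "\<bar>\<xi> (rho u)\<bar> \<le> c" for u using bounds[of "rho u"] by auto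
  qed measurable
  show "decay c t s = exp (LINT u:{s..<t}|lborel. \<xi> (rho u))" if "t0 \<le> s" "s \<in> T" "t \<in> T"
    using delta_integral_eq[OF that, of \<xi>] int unfolding delta_exp_def \<xi>_def by simp
qed

lemma decay_pos: "0 < decay c t s"
  by (simp add: delta_exp_def)

lemma decay_split:
  assumes "c > 0" "t0 \<le> s" "s \<in> T" "r \<in> T" "t \<in> T" "s \<le> r" "r \<le> t"
  shows "decay c t s = decay c t r * decay c r s"
  using assms set_integral_Ico_split[OF decay_exponent_integrable[OF assms(1)], of s r t]
  by (simp add: decay_eq exp_add)

lemma decay_le_1:
  assumes "c > 0" "t0 \<le> s" "s \<in> T" "t \<in> T"
  shows "decay c t s \<le> 1"
proof -
  have "0 \<le> (LINT u:{s..<t}|lborel. - cylinder_transform (graininess T (rho u)) (circle_minus T (\<lambda>_. c) (rho u)))"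
    using decay_exponent_bounds(2)[OF assms(1)] by (intro set_integral_nonneg_real) auto
  then show ?thesis
    using assms decay_exponent_integrable[OF assms(1)] by (simp add: decay_eq set_integral_uminus)
qed

text \<open>The exponent never falls below \<open>- c\<close>: gaps can only slow the decay down.
  Through this bound the boundedness of \<open>delay_inv T t0 \<alpha> s - s\<close> enters the
  proof.\<close>

lemma decay_ge:
  assumes "c > 0" "t0 \<le> s" "s \<in> T" "t \<in> T" "s \<le> t"
  shows "exp (- c * (t - s)) \<le> decay c t s"
proof -
  have "(LINT u:{s..<t}|lborel. - c) \<le>
      (LINT u:{s..<t}|lborel. cylinder_transform (graininess T (rho u)) (circle_minus T (\<lambda>_. c) (rho u)))"
    by (rule set_integral_mono[OF _ decay_exponent_integrable[OF assms(1)]])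
      (use decay_exponent_bounds(1)[OF assms(1)] assms(5) in \<open>auto simp: set_integrable_def\<close>)
  moreover have "(LINT u:{s..<t}|lborel. - c) = - c * (t - s)"
    using assms(5) by (simp add: set_lebesgue_integral_def)
  ultimately show ?thesis using assms by (simp add: decay_eq)
qed

end

section \<open>The delay equation\<close>

locale delay_equation = unbounded_time_scale +
  fixes A \<alpha> :: "real \<Rightarrow> real"
  assumes A_nonneg: "t \<in> T \<inter> {t0..} \<Longrightarrow> A t \<ge> 0"
    and A_rd: "rd_continuous_on T (T \<inter> {t0..}) A"
    and \<alpha>_in: "t \<in> T \<inter> {t0..} \<Longrightarrow> \<alpha> t \<in> T"
    and \<alpha>_rd: "rd_continuous_on T (T \<inter> {t0..}) \<alpha>"
    and \<alpha>_le: "t \<in> T \<inter> {t0..} \<Longrightarrow> \<alpha> t \<le> t"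
    and \<alpha>_lim: "filterlim \<alpha> at_top (inf at_top (principal (T \<inter> {t0..})))"
begin

definition coef :: "real \<Rightarrow> real" where "coef u = A (rho u)"

definition del :: "real \<Rightarrow> real" where "del u = \<alpha> (rho u)"

abbreviation sol :: "real \<Rightarrow> real \<Rightarrow> (real \<Rightarrow> real) \<Rightarrow> (real \<Rightarrow> real) \<Rightarrow> bool" where
  "sol \<equiv> is_solution T A \<alpha>"

abbreviation fund :: "real \<Rightarrow> real \<Rightarrow> real" where
  "fund \<equiv> fundamental_solution T A \<alpha>"

lemma coef_nonneg: "0 \<le> coef u"
  using A_nonneg rho_in rho_ge_t0 by (simp add: coef_def)

lemma del_in: "del u \<in> T"
  using \<alpha>_in rho_in rho_ge_t0 by (simp add: del_def)

lemma del_le: "t0 \<le> u \<Longrightarrow> del u \<le> u"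
  using \<alpha>_le[of "rho u"] rho_in rho_ge_t0 rho_le[of u] by (simp add: del_def)

lemma borel_measurable_coef [measurable]: "coef \<in> borel_measurable borel"
  using borel_measurable_rd_continuous_rho[OF A_rd] by (simp add: coef_def[abs_def])

lemma borel_measurable_del [measurable]: "del \<in> borel_measurable borel"
  using borel_measurable_rd_continuous_rho[OF \<alpha>_rd] by (simp add: del_def[abs_def])

lemma coef_bound: "\<exists>B>0. \<forall>u\<le>b. coef u \<le> B"
proof -
  obtain B where B: "\<And>x. x \<in> T \<inter> {t0..max t0 b} \<Longrightarrow> \<bar>A x\<bar> \<le> B"
    using bounded_rd_continuous[OF A_rd, of "max t0 b"] unfolding bounded_iff real_norm_def by blast
  have "coef u \<le> max B 1" if "u \<le> b" for u
    using B[of "rho u"] rho_in rho_ge_t0 rho_le_max[of u] that by (force simp: coef_def)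
  then show ?thesis by (intro exI[of _ "max B 1"]) auto
qed

lemma \<alpha>_large: "\<exists>N. \<forall>\<eta>\<in>T \<inter> {t0..}. N \<le> \<eta> \<longrightarrow> Z \<le> \<alpha> \<eta>"
proof -
  have "\<forall>\<^sub>F \<eta> in inf at_top (principal (T \<inter> {t0..})). Z \<le> \<alpha> \<eta>"
    using \<alpha>_lim by (simp add: filterlim_at_top)
  then show ?thesis
    by (auto simp: eventually_inf_principal eventually_at_top_linorder)
qed

text \<open>Makes the infimum in \<open>delay_low\<close> genuine: \<alpha> is nonnegative from some
  point on and bounded on the compact part before it.\<close>

lemma bdd_below_\<alpha>: "bdd_below (\<alpha> ` (T \<inter> {t0..}))"
proof -
  obtain N where N: "\<forall>\<eta>\<in>T \<inter> {t0..}. N \<le> \<eta> \<longrightarrow> 0 \<le> \<alpha> \<eta>"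
    using \<alpha>_large by blast
  obtain C where C: "\<And>x. x \<in> T \<inter> {t0..N} \<Longrightarrow> \<bar>\<alpha> x\<bar> \<le> C"
    using bounded_rd_continuous[OF \<alpha>_rd, of N] unfolding bounded_iff real_norm_def by blast
  show ?thesis
  proof (rule bdd_belowI2)
    fix \<eta> assume "\<eta> \<in> T \<inter> {t0..}"
    then show "min 0 (- C) \<le> \<alpha> \<eta>"
      using N C[of \<eta>] by (cases "N \<le> \<eta>") auto
  qed
qed

lemma delay_low_le:
  assumes "t0 \<le> s" "s \<le> \<eta>" "\<eta> \<in> T"
  shows "delay_low T \<alpha> s \<le> \<alpha> \<eta>"
  unfolding delay_low_def
  by (rule cINF_lower[OF bdd_below_mono[OF bdd_below_\<alpha>]]) (use assms in auto)

lemma delay_low_le_self: "s \<in> T \<Longrightarrow> t0 \<le> s \<Longrightarrow> delay_low T \<alpha> s \<le> s"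
  using delay_low_le[of s s] \<alpha>_le[of s] by simp

lemma delay_low_le_del: "s \<in> T \<Longrightarrow> t0 \<le> s \<Longrightarrow> s \<le> u \<Longrightarrow> delay_low T \<alpha> s \<le> del u"
  unfolding del_def by (intro delay_low_le rho_in rho_ge)

lemma del_in_initial_interval:
  "s \<in> T \<Longrightarrow> t0 \<le> s \<Longrightarrow> s \<le> u \<Longrightarrow> del u < s \<Longrightarrow> del u \<in> initial_interval T \<alpha> s"
  using delay_low_le_del del_in by (auto simp: initial_interval_def)

lemma sol_iff:
  assumes "s \<in> T" "t0 \<le> s"
  shows "sol s x0 \<phi> x \<longleftrightarrow>
    (\<forall>t\<in>initial_interval T \<alpha> s. x t = \<phi> t) \<and> x s = x0 \<and>
    (\<forall>t\<in>T \<inter> {s..}. set_integrable lborel {s..<t} (\<lambda>u. coef u * x (del u)) \<and>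
        x t = x0 - (LINT u:{s..<t}|lborel. coef u * x (del u)))"
proof -
  have "delta_integrable T (\<lambda>\<eta>. A \<eta> * x (\<alpha> \<eta>)) s t \<longleftrightarrow>
      set_integrable lborel {s..<t} (\<lambda>u. coef u * x (del u))"
    and "set_integrable lborel {s..<t} (\<lambda>u. coef u * x (del u)) \<Longrightarrow>
      delta_integral T (\<lambda>\<eta>. A \<eta> * x (\<alpha> \<eta>)) s t = (LINT u:{s..<t}|lborel. coef u * x (del u))"
    if "t \<in> T" for t
    using delta_integrable_iff[OF assms(2,1) that, of "\<lambda>\<eta>. A \<eta> * x (\<alpha> \<eta>)"]
      delta_integral_eq[OF assms(2,1) that, of "\<lambda>\<eta>. A \<eta> * x (\<alpha> \<eta>)"]
    by (simp_all add: coef_def del_def)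
  then show ?thesis unfolding is_solution_def by auto
qed

lemma sol_cong:
  assumes "s \<in> T" "t0 \<le> s" and eq: "\<And>t. t \<in> T \<Longrightarrow> delay_low T \<alpha> s \<le> t \<Longrightarrow> x t = y t"
    and x: "sol s x0 \<phi> x"
  shows "sol s x0 \<phi> y"
proof -
  have init: "\<forall>t\<in>initial_interval T \<alpha> s. x t = y t"
    using eq by (auto simp: initial_interval_def)
  have pt: "x t = y t" if "t \<in> T" "s \<le> t" for t
    using eq[of t] delay_low_le_self[of s] assms that by auto
  have del: "x (del u) = y (del u)" if "s \<le> u" for u
    using eq[OF del_in] delay_low_le_del that assms by blast
  have "set_integrable lborel {s..<t} (\<lambda>u. coef u * y (del u)) \<longleftrightarrow>
      set_integrable lborel {s..<t} (\<lambda>u. coef u * x (del u))" for t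
    by (rule set_integrable_cong) (auto simp: del)
  moreover have "(LINT u:{s..<t}|lborel. coef u * y (del u)) =
      (LINT u:{s..<t}|lborel. coef u * x (del u))" for t
    by (rule set_lebesgue_integral_cong) (auto simp: del)
  ultimately show ?thesis
    using x init pt assms(1) unfolding sol_iff[OF assms(1,2)] by auto
qed

section \<open>Weighted norm, uniqueness and existence\<close>

lemma weighted_integral_bound:
  assumes "B > 0" "\<And>u. u < r \<Longrightarrow> coef u \<le> B" "s \<le> r" "N \<ge> 0"
    and int: "set_integrable lborel {s..<r} (\<lambda>u. coef u * z (del u))"
    and z: "\<And>u. s \<le> u \<Longrightarrow> u < r \<Longrightarrow> \<bar>z (del u)\<bar> \<le> N * exp (2 * B * (u - s))"
  shows "\<bar>LINT u:{s..<r}|lborel. coef u * z (del u)\<bar> \<le> N / 2 * exp (2 * B * (r - s))"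
proof -
  have "\<bar>LINT u:{s..<r}|lborel. coef u * z (del u)\<bar> \<le>
      (LINT u:{s..<r}|lborel. B * (N * exp (2 * B * (u - s))))"
    using exp_set_integral_le(1)[OF assms(1,4,3)] int
  proof (intro abs_set_integral_le)
    fix u assume "u \<in> {s..<r}"
    then show "\<bar>coef u * z (del u)\<bar> \<le> B * (N * exp (2 * B * (u - s)))"
      using assms(1,2) z[of u] coef_nonneg[of u] by (auto simp: abs_mult intro!: mult_mono)
  qed
  also have "\<dots> \<le> N / 2 * exp (2 * B * (r - s))" by (rule exp_set_integral_le(2)[OF assms(1,4,3)])
  finally show ?thesis .
qed

text \<open>In the norm with weight \<open>exp (2 * B * (q - s))\<close>, the integral operator halves norms.\<close>

lemma gronwall:
  assumes s: "t0 \<le> s" and B: "B > 0" "\<And>u. u < b \<Longrightarrow> coef u \<le> B" and c: "c \<ge> 0"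
    and z: "\<And>q. q \<in> T \<Longrightarrow> s \<le> q \<Longrightarrow> q \<le> b \<Longrightarrow>
      \<bar>z q\<bar> \<le> c + \<bar>LINT u:{s..<q}|lborel. coef u * z (del u)\<bar>"
    and z0: "\<And>u. s \<le> u \<Longrightarrow> u < b \<Longrightarrow> del u < s \<Longrightarrow> z (del u) = 0"
    and int: "set_integrable lborel {s..<b} (\<lambda>u. coef u * z (del u))"
    and q: "q \<in> T" "s \<le> q" "q \<le> b"
  shows "\<bar>z q\<bar> \<le> 2 * c * exp (2 * B * (q - s))"
proof -
  let ?w = "\<lambda>q. exp (2 * B * (q - s))" and ?g = "\<lambda>u. coef u * z (del u)"
  \<comment> \<open>A crude a priori bound that comes from integrability alone; its contribution is
    halved at each iteration and disappears in the limit.\<close>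
  define N0 where "N0 = c + (LINT u:{s..<b}|lborel. \<bar>?g u\<bar>)"
  have N0: "N0 \<ge> 0" using c by (auto simp: N0_def intro!: add_nonneg_nonneg set_integral_nonneg_real)
  have intq: "set_integrable lborel {s..<q} ?g" if "q \<le> b" for q
    by (rule set_integrable_subset[OF int]) (use that in auto)
  \<comment> \<open>The part \<open>2 * c\<close> reproduces itself under the iteration, since c +
    (2c)/2 = 2c.\<close>
  have "\<bar>z q\<bar> \<le> (2 * c + N0 / 2 ^ n) * ?w q" if "q \<in> T" "s \<le> q" "q \<le> b" for q n
    using that
  proof (induction n arbitrary: q)
    case 0
    have "\<bar>z q\<bar> \<le> c + \<bar>LINT u:{s..<q}|lborel. ?g u\<bar>" using 0 by (rule z)
    also have "\<bar>LINT u:{s..<q}|lborel. ?g u\<bar> \<le> (LINT u:{s..<q}|lborel. \<bar>?g u\<bar>)"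
      using intq[OF 0(3)] by (intro abs_set_integral_le set_integrable_abs) auto
    also have "\<dots> \<le> (LINT u:{s..<b}|lborel. \<bar>?g u\<bar>)"
      using set_integral_Ico_split[OF set_integrable_abs[OF int] 0(2,3)]
        set_integral_nonneg_real[of "{q..<b}" "\<lambda>u. \<bar>?g u\<bar>" lborel] by simp
    finally have "\<bar>z q\<bar> \<le> N0" by (simp add: N0_def)
    also have "\<dots> \<le> (2 * c + N0) * 1" using c by simp
    also have "\<dots> \<le> (2 * c + N0) * ?w q" using c N0 B 0 by (intro mult_left_mono) auto
    finally show ?case by simp
  next
    case (Suc n)
    let ?N = "2 * c + N0 / 2 ^ n"
    have N: "?N \<ge> 0" using c N0 by simp
    have zd: "\<bar>z (del u)\<bar> \<le> ?N * ?w u" if "s \<le> u" "u < q" for u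
    proof (cases "del u < s")
      case True
      then show ?thesis using z0[of u] that N Suc.prems by simp
    next
      case False
      have du: "del u \<le> u" using del_le s that by simp
      then have "\<bar>z (del u)\<bar> \<le> ?N * ?w (del u)"
        using False that Suc.prems by (intro Suc.IH del_in) auto
      also have "\<dots> \<le> ?N * ?w u" using du B N by (intro mult_left_mono) auto
      finally show ?thesis .
    qed
    have "\<bar>z q\<bar> \<le> c + \<bar>LINT u:{s..<q}|lborel. ?g u\<bar>" using Suc.prems by (rule z)
    moreover have "\<bar>LINT u:{s..<q}|lborel. ?g u\<bar> \<le> ?N / 2 * ?w q"
      using B Suc.prems N intq zd by (intro weighted_integral_bound) auto
    moreover have "c \<le> c * ?w q" using c B Suc.prems by (simp add: mult_le_cancel_left1)
    ultimately have "\<bar>z q\<bar> \<le> c * ?w q + ?N / 2 * ?w q" by linarith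
    also have "\<dots> = (2 * c + N0 / 2 ^ Suc n) * ?w q" by (simp add: field_simps)
    finally show ?case .
  qed
  then have le: "\<bar>z q\<bar> \<le> (2 * c + N0 / 2 ^ n) * ?w q" for n using q by blast
  have "(\<lambda>n. (2 * c + N0 / 2 ^ n) * ?w q) \<longlonglongrightarrow> (2 * c + 0) * ?w q"
    by (intro tendsto_intros LIMSEQ_divide_realpow_zero) auto
  from LIMSEQ_le_const[OF this] le show ?thesis by auto
qed

text \<open>The difference of two solutions has zero history and zero initial value, so
  \<open>gronwall\<close> applies with \<open>c = 0\<close>.\<close>

lemma sol_unique:
  assumes s: "s \<in> T" "t0 \<le> s" and x: "sol s x0 \<phi> x" and y: "sol s x0 \<phi> y"
    and t: "t \<in> T" "delay_low T \<alpha> s \<le> t"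
  shows "x t = y t"
proof (cases "t < s")
  case True
  then show ?thesis using x y t by (auto simp: is_solution_def initial_interval_def)
next
  case False
  let ?z = "\<lambda>q. x q - y q"
  note X = x[unfolded sol_iff[OF s]] and Y = y[unfolded sol_iff[OF s]]
  obtain B where B: "B > 0" "\<And>u. u \<le> t \<Longrightarrow> coef u \<le> B" using coef_bound by blast
  have int: "set_integrable lborel {s..<q} (\<lambda>u. coef u * ?z (del u))" if "q \<in> T" "s \<le> q" for q
    using X Y that by (auto simp: right_diff_distrib)
  have "\<bar>?z t\<bar> \<le> 2 * 0 * exp (2 * B * (t - s))"
  proof (rule gronwall[where b = t])
    fix q assume q: "q \<in> T" "s \<le> q" "q \<le> t"
    then have "?z q = - (LINT u:{s..<q}|lborel. coef u * ?z (del u))"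
      using X Y by (simp add: right_diff_distrib)
    then show "\<bar>?z q\<bar> \<le> 0 + \<bar>LINT u:{s..<q}|lborel. coef u * ?z (del u)\<bar>" by simp
  next
    fix u assume "s \<le> u" "del u < s"
    then have "del u \<in> initial_interval T \<alpha> s" using s by (intro del_in_initial_interval)
    then show "?z (del u) = 0" using X Y by simp
  qed (use s t B False int in auto)
  then show ?thesis by simp
qed

text \<open>The iterates live on the whole line rather than on \<open>T\<close>, which makes them
  Borel functions that can be composed with \<open>del\<close>. Iteration and limit are independent
  of any horizon; the bound \<open>B\<close> and the weight are chosen afterwards for each
  \<open>b\<close>.\<close>

lemma sol_exists:
  assumes s: "s \<in> T" "t0 \<le> s"
  shows "\<exists>x. sol s 1 (\<lambda>_. 0) x"
proof -
  define P where "P x q = (if q < s then 0 else 1 - (LINT u:{s..<q}|lborel. coef u * x (del u)))"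
    for x :: "real \<Rightarrow> real" and q
  define X where "X n = (P ^^ n) (\<lambda>q. if q < s then 0 else 1)" for n
  have X0: "X 0 = (\<lambda>q. if q < s then 0 else 1)" and XSuc: "X (Suc n) = P (X n)" for n
    by (simp_all add: X_def)
  have X_before: "X n q = 0" if "q < s" for n q
    using that by (cases n) (auto simp: X0 XSuc P_def)
  have Xm [measurable]: "X n \<in> borel_measurable borel" for n
  proof (induction n)
    case 0 show ?case unfolding X0 by measurable
  next
    case (Suc n)
    note [measurable] = Suc
    \<comment> \<open>The integral depends on \<open>q\<close> through its domain, so joint
      measurability in \<open>q\<close> and \<open>u\<close> is needed; writing the interval as
      inequalities exposes it.\<close>
    show ?case
      unfolding XSuc P_def[abs_def] set_lebesgue_integral_def indicator_def atLeastLessThan_iff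
      by measurable
  qed
  define x where "x q = lim (\<lambda>n. X n q)" for q
  have main: "set_integrable lborel {s..<b} (\<lambda>u. coef u * x (del u)) \<and>
      x b = 1 - (LINT u:{s..<b}|lborel. coef u * x (del u))" if b: "s \<le> b" for b
  proof -
    obtain B where B: "B > 0" "\<And>u. u \<le> b \<Longrightarrow> coef u \<le> B" using coef_bound by blast
    let ?w = "\<lambda>q. exp (2 * B * (q - s))"
    have w1: "1 \<le> ?w q" if "s \<le> q" for q using B that by simp
    \<comment> \<open>A weighted bound survives the delay because the weight increases and
      \<open>z\<close> vanishes before \<open>s\<close>.\<close>
    have wd: "\<bar>z (del u)\<bar> \<le> N * ?w u"
      if "s \<le> u" "u < b" "N \<ge> 0" "\<And>q. q < s \<Longrightarrow> z q = 0"
        "\<And>q. s \<le> q \<Longrightarrow> q \<le> b \<Longrightarrow> \<bar>z q\<bar> \<le> N * ?w q" for z :: "real \<Rightarrow> real" and u N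
    proof (cases "del u < s")
      case True then show ?thesis using that by simp
    next
      case False
      have du: "del u \<le> u" using del_le s that by simp
      then have "\<bar>z (del u)\<bar> \<le> N * ?w (del u)" using False that by simp
      also have "\<dots> \<le> N * ?w u" using du B that by (intro mult_left_mono) auto
      finally show ?thesis .
    qed
    have bound: "\<bar>coef u * z (del u)\<bar> \<le> B * (N * ?w b)"
      if "s \<le> u" "u < b" "N \<ge> 0" "\<bar>z (del u)\<bar> \<le> N * ?w u" for z :: "real \<Rightarrow> real" and u N
    proof -
      have "\<bar>z (del u)\<bar> \<le> N * ?w b"
        using that B by (elim order_trans) (auto intro!: mult_left_mono)
      then show ?thesis
        using B that coef_nonneg[of u] by (auto simp: abs_mult intro!: mult_mono)
    qed
    have int: "set_integrable lborel {s..<q} (\<lambda>u. coef u * z (del u))"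
      if "q \<le> b" "z \<in> borel_measurable borel" "N \<ge> 0" "\<And>q. q < s \<Longrightarrow> z q = 0"
        "\<And>q. s \<le> q \<Longrightarrow> q \<le> b \<Longrightarrow> \<bar>z q\<bar> \<le> N * ?w q" for z :: "real \<Rightarrow> real" and q N
    proof (rule set_integrable_bounded_Ico)
      have [measurable]: "z \<in> borel_measurable borel" by fact
      show "(\<lambda>u. coef u * z (del u)) \<in> borel_measurable borel" by measurable
      fix u assume u: "s \<le> u" "u < q"
      then have "\<bar>z (del u)\<bar> \<le> N * ?w u" 
        by (intro wd[where z = z and N = N and u = u]) (use that in simp_all)
      then show "\<bar>coef u * z (del u)\<bar> \<le> B * (N * ?w b)" using u that by (intro bound) auto
    qed
    \<comment> \<open>The iterates stay in the weighted ball of radius 2, since 1 + 2/2 = 2. This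
      also supplies the dominating function \<open>?h\<close> below.\<close>
    have X2: "\<bar>X n q\<bar> \<le> 2 * ?w q" if "s \<le> q" "q \<le> b" for n q
      using that
    proof (induction n arbitrary: q)
      case 0
      then have "X 0 q = 1" by (simp add: X0)
      with w1[OF 0(1)] show ?case by linarith
    next
      case (Suc n)
      have "\<bar>X n (del u)\<bar> \<le> 2 * ?w u" if "s \<le> u" "u < q" for u
        by (rule wd[where z = "X n"]) (use that Suc in \<open>auto simp: X_before\<close>)
      moreover have "set_integrable lborel {s..<q} (\<lambda>u. coef u * X n (del u))"
        by (rule int[where z = "X n" and N = 2]) (use Suc in \<open>auto simp: X_before\<close>)
      ultimately have "\<bar>LINT u:{s..<q}|lborel. coef u * X n (del u)\<bar> \<le> 2 / 2 * ?w q"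
        using Suc.prems B by (intro weighted_integral_bound) auto
      moreover have "X (Suc n) q = 1 - (LINT u:{s..<q}|lborel. coef u * X n (del u))"
        using Suc.prems by (simp add: XSuc P_def)
      ultimately show ?case using w1[OF Suc.prems(1)] by linarith
    qed
    have intX: "set_integrable lborel {s..<q} (\<lambda>u. coef u * X n (del u))" if "q \<le> b" for n q
      by (rule int[where z = "X n" and N = 2]) (use that X2 in \<open>auto simp: X_before\<close>)
    \<comment> \<open>Geometric decay of the increments; telescoping turns it into pointwise
      convergence of the iterates.\<close>
    have Xdiff: "\<bar>X (Suc n) q - X n q\<bar> \<le> (1 / 2) ^ n * ?w q" if "s \<le> q" "q \<le> b" for n q
      using that
    proof (induction n arbitrary: q)
      case 0
      have "\<bar>X 0 (del u)\<bar> \<le> 1 * ?w u" if "s \<le> u" "u < q" for u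
        by (rule wd[where z = "X 0"]) (use that 0 w1 in \<open>auto simp: X0\<close>)
      then have "\<bar>LINT u:{s..<q}|lborel. coef u * X 0 (del u)\<bar> \<le> 1 / 2 * ?w q"
        using 0 B intX[of q 0] by (intro weighted_integral_bound) auto
      moreover have "X (Suc 0) q - X 0 q = - (LINT u:{s..<q}|lborel. coef u * X 0 (del u))"
        using 0 by (auto simp: XSuc P_def X0)
      ultimately show ?case by simp
    next
      case (Suc n)
      have e: "X (Suc k) q = 1 - (LINT u:{s..<q}|lborel. coef u * X k (del u))" for k
        using Suc.prems by (simp add: XSuc P_def)
      have "X (Suc (Suc n)) q - X (Suc n) q =
          - (LINT u:{s..<q}|lborel. coef u * (X (Suc n) (del u) - X n (del u)))"
        using intX[OF Suc.prems(2)] by (simp add: e right_diff_distrib)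
      also have "\<bar>\<dots>\<bar> \<le> (1 / 2) ^ n / 2 * ?w q"
      proof -
        have "\<bar>X (Suc n) (del u) - X n (del u)\<bar> \<le> (1 / 2) ^ n * ?w u" if "s \<le> u" "u < q" for u
          by (rule wd[where z = "\<lambda>q. X (Suc n) q - X n q"]) (use that Suc in \<open>auto simp: X_before\<close>)
        moreover have "set_integrable lborel {s..<q} (\<lambda>u. coef u * (X (Suc n) (del u) - X n (del u)))"
          using intX[of q] Suc.prems by (simp add: right_diff_distrib)
        ultimately show ?thesis
          unfolding abs_minus_cancel using Suc.prems B
          by (intro weighted_integral_bound[where z = "\<lambda>q. X (Suc n) q - X n q"]) auto
      qed
      finally show ?case by simp
    qed
    have lim: "(\<lambda>n. X n q) \<longlonglongrightarrow> x q" if "q \<le> b" for q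
    proof (cases "q < s")
      case True then show ?thesis by (simp add: X_before x_def)
    next
      case False
      have "summable (\<lambda>n. X (Suc n) q - X n q)"
      proof (rule summable_comparison_test')
        show "summable (\<lambda>n. (1 / 2) ^ n * ?w q)" by (intro summable_mult2 summable_geometric) simp
      qed (use Xdiff False that in auto)
      then have "convergent (\<lambda>n. \<Sum>i<n. X (Suc i) q - X i q)"
        using summable_iff_convergent by blast
      then have "convergent (\<lambda>n. X n q - X 0 q)" 
        using sum_lessThan_telescope[of "\<lambda>n. X n q"] by simp
      then have "convergent (\<lambda>n. X n q - X 0 q + X 0 q)" by (intro convergent_add convergent_const)
      then show ?thesis by (simp add: x_def convergent_LIMSEQ_iff)
    qed
    let ?f = "\<lambda>n u. indicator {s..<b} u *\<^sub>R (coef u * X n (del u))"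
    let ?g = "\<lambda>u. indicator {s..<b} u *\<^sub>R (coef u * x (del u))"
    let ?h = "\<lambda>u. indicator {s..<b} u *\<^sub>R (B * (2 * ?w b))"
    have fg: "(\<lambda>n. ?f n u) \<longlonglongrightarrow> ?g u" for u
      using lim[of "del u"] del_le[of u] s
      by (cases "u \<in> {s..<b}") (auto intro!: tendsto_intros)
    have fm: "?f n \<in> borel_measurable lborel" for n by measurable
    then have gm: "?g \<in> borel_measurable lborel" by (rule borel_measurable_LIMSEQ_real[OF fg])
    have fh: "norm (?f n u) \<le> ?h u" for n u
      using bound[of u 2 "X n"] wd[of u 2 "X n"] X2 X_before by (auto simp: indicator_def)
    have h: "integrable lborel ?h"
      using set_integrable_bounded_Ico[of "\<lambda>_. B * (2 * ?w b)" s b] B by (auto simp: set_integrable_def)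
    have "integrable lborel ?g"
      by (rule integrable_dominated_convergence[where s = ?f, OF gm fm h]) (use fg fh in auto)
    moreover have "(\<lambda>n. integral\<^sup>L lborel (?f n)) \<longlonglongrightarrow> integral\<^sup>L lborel ?g"
      by (rule integral_dominated_convergence[where s = ?f, OF gm fm h]) (use fg fh in auto)
    then have "(\<lambda>n. X (Suc n) b) \<longlonglongrightarrow> 1 - integral\<^sup>L lborel ?g"
      using b by (simp add: XSuc P_def set_lebesgue_integral_def tendsto_intros)
    moreover have "(\<lambda>n. X (Suc n) b) \<longlonglongrightarrow> x b" using lim[of b] by (rule LIMSEQ_Suc) simp
    ultimately show ?thesis
      using LIMSEQ_unique by (auto simp: set_integrable_def set_lebesgue_integral_def)
  qed
  have "x t = 0" if "t \<in> initial_interval T \<alpha> s" for t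
    using that by (simp add: x_def X_before initial_interval_def)
  moreover have "x s = 1" using main[of s] by (simp add: set_lebesgue_integral_def)
  ultimately have "sol s 1 (\<lambda>_. 0) x"
    unfolding sol_iff[OF s] using main by auto
  then show ?thesis by blast
qed

text \<open>Justifies the definite description: a solution restricted to its domain is extensional,
  and extensionality upgrades uniqueness on the domain to equality of functions.\<close>

lemma fund_sol:
  assumes s: "s \<in> T" "t0 \<le> s"
  shows "sol s 1 (\<lambda>_. 0) (\<lambda>t. fund t s)"
proof -
  let ?S = "T \<inter> {delay_low T \<alpha> s..}"
  obtain x where "sol s 1 (\<lambda>_. 0) x" using sol_exists[OF s] by blast
  then have "sol s 1 (\<lambda>_. 0) (restrict x ?S)" by (rule sol_cong[OF s, rotated]) auto
  then have "\<exists>!x. x \<in> extensional ?S \<and> sol s 1 (\<lambda>_. 0) x"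
  proof (intro ex1I[of _ "restrict x ?S"])
    fix y assume "y \<in> extensional ?S \<and> sol s 1 (\<lambda>_. 0) y" "sol s 1 (\<lambda>_. 0) (restrict x ?S)"
    then show "y = restrict x ?S"
      using sol_unique[OF s, of 1 "\<lambda>_. 0" y "restrict x ?S"]
      by (intro extensionalityI[of y ?S]) auto
  qed auto
  then have "(THE x. x \<in> extensional ?S \<and> sol s 1 (\<lambda>_. 0) x) \<in> extensional ?S \<and>
      sol s 1 (\<lambda>_. 0) (THE x. x \<in> extensional ?S \<and> sol s 1 (\<lambda>_. 0) x)" by (rule theI')
  then show ?thesis unfolding fundamental_solution_def by simp
qed

section \<open>Superposition of fundamental solutions\<close>

lemma set_integrable_coef: "set_integrable lborel {s..<t} coef"
proof -
  obtain B where "B > 0" "\<And>u. u \<le> t \<Longrightarrow> coef u \<le> B" using coef_bound by blast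
  then show ?thesis
    using coef_nonneg by (intro set_integrable_bounded_Ico[where C = B]) auto
qed

lemma coef_integral_le:
  assumes "s \<le> t" "\<And>u. u < t \<Longrightarrow> coef u \<le> B"
  shows "(LINT u:{s..<t}|lborel. coef u) \<le> B * (t - s)"
proof -
  have "(LINT u:{s..<t}|lborel. coef u) \<le> (LINT u:{s..<t}|lborel. B)"
    by (rule set_integral_mono[OF set_integrable_coef])
      (use assms in \<open>auto simp: set_integrable_def\<close>)
  also have "\<dots> = B * (t - s)" using assms(1) by (simp add: set_lebesgue_integral_def)
  finally show ?thesis .
qed

text \<open>Below \<open>delay_low T \<alpha> r\<close> the value of \<open>fund\<close> is
  unspecified. Extending the zero history to everything before \<open>r\<close> lets fundamental
  solutions with different starting points be added in one equation.\<close>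

definition fund_ext :: "real \<Rightarrow> real \<Rightarrow> real" where
  "fund_ext r q = (if q < r then 0 else fund q r)"

text \<open>Seen from \<open>s\<close>, the extension is the response to a unit impulse at
  \<open>r\<close>: a step function takes the place of the initial value, and the integrand vanishes
  before \<open>r\<close> because \<open>del u \<le> u\<close>.\<close>

lemma fund_ext_eq:
  assumes "r \<in> T" "q \<in> T" "t0 \<le> s" "s \<le> r"
  shows "set_integrable lborel {s..<q} (\<lambda>u. coef u * fund_ext r (del u))"
    and "fund_ext r q = (if q < r then 0 else 1) - (LINT u:{s..<q}|lborel. coef u * fund_ext r (del u))"
proof -
  let ?g = "\<lambda>u. coef u * fund_ext r (del u)"
  have r: "r \<in> T" "t0 \<le> r" using assms by auto
  note F = fund_sol[OF r, unfolded sol_iff[OF r]]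
  have early: "fund_ext r (del u) = 0" if "s \<le> u" "u < r" for u
    using del_le[of u] that assms by (auto simp: fund_ext_def)
  have late: "fund_ext r (del u) = fund (del u) r" if "r \<le> u" for u
    using F del_in_initial_interval[OF r that] by (auto simp: fund_ext_def)
  have "set_integrable lborel {s..<q} ?g \<and>
    fund_ext r q = (if q < r then 0 else 1) - (LINT u:{s..<q}|lborel. ?g u)"
  proof (cases "q < r")
    case True
    then have "(\<lambda>u. indicator {s..<q} u *\<^sub>R ?g u) = (\<lambda>u. 0)"
      using early by (auto simp: indicator_def)
    then show ?thesis
      using True by (simp add: set_integrable_def set_lebesgue_integral_def fund_ext_def)
  next
    case False
    then have eq: "(\<lambda>u. indicator {s..<q} u *\<^sub>R ?g u) =
        (\<lambda>u. indicator {r..<q} u *\<^sub>R (coef u * fund (del u) r))"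
      using early late assms by (auto simp: indicator_def fun_eq_iff)
    have "set_integrable lborel {r..<q} (\<lambda>u. coef u * fund (del u) r) \<and>
        fund q r = 1 - (LINT u:{r..<q}|lborel. coef u * fund (del u) r)"
      using F assms False by auto
    then show ?thesis
      unfolding set_integrable_def set_lebesgue_integral_def eq
      using False by (simp add: fund_ext_def)
  qed
  then show "set_integrable lborel {s..<q} ?g"
    "fund_ext r q = (if q < r then 0 else 1) - (LINT u:{s..<q}|lborel. ?g u)" by auto
qed

text \<open>The bound read off from the variation of constants formula. The formula itself is only needed
  up to an error that vanishes with the mesh \<open>h\<close> of a partition \<open>r\<close> of \<open>[s,m]\<close>: the forcing caused by
  the initial function on \<open>[r i, r (i + 1))\<close> is replaced with its total mass, placed at \<open>r (i + 1)\<close>.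
  As grid points are rounded up to \<^term>\<open>T\<close>, a point of \<^term>\<open>T\<close> in this interval exceeds \<open>r i\<close> by
  at most \<open>h\<close>, even in the presence of gaps.\<close>

lemma solution_bound:
  assumes s: "s \<in> T" "t0 \<le> s" and x: "sol s x0 \<phi> x"
    and \<Phi>: "\<Phi> \<ge> 0" "\<And>q. q \<in> initial_interval T \<alpha> s \<Longrightarrow> \<bar>\<phi> q\<bar> \<le> \<Phi>"
    and t: "t \<in> T" and m: "m \<in> T" "s \<le> m" "m \<le> t"
    and late: "\<And>u. m < u \<Longrightarrow> u < t \<Longrightarrow> s \<le> del u"
    and M: "\<And>r. r \<in> T \<Longrightarrow> s \<le> r \<Longrightarrow> r \<le> m \<Longrightarrow> \<bar>fund t r\<bar> \<le> M"
  shows "\<bar>x t\<bar> \<le> \<bar>x0\<bar> * \<bar>fund t s\<bar> + M * (\<Phi> * (LINT u:{s..<m}|lborel. coef u))"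
proof -
  note X = x[unfolded sol_iff[OF s]]
  obtain B where B: "B > 0" "\<And>u. u \<le> t \<Longrightarrow> coef u \<le> B" using coef_bound by blast
  have M0: "M \<ge> 0" using M[of s] s m by (smt (verit) abs_ge_zero)
  \<comment> \<open>The part of the delayed term that reads the initial function. It acts as an
    inhomogeneity, entering the equation with a minus sign.\<close>
  define f where "f u = (if del u < s then coef u * x (del u) else 0)" for u
  define F where "F q = (LINT u:{s..<q}|lborel. f u)" for q
  define V where "V q = (LINT u:{s..<q}|lborel. coef u)" for q
  have f_le: "\<bar>f u\<bar> \<le> \<Phi> * coef u" if "s \<le> u" for u
  proof (cases "del u < s")
    case True
    then have "\<bar>x (del u)\<bar> \<le> \<Phi>" using X \<Phi> del_in_initial_interval[OF s that True] by auto
    then show ?thesis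
      using coef_nonneg[of u] by (auto simp: f_def abs_mult mult.commute[of \<Phi>] intro!: mult_left_mono)
  qed (use \<Phi> coef_nonneg in \<open>auto simp: f_def\<close>)
  have intx: "set_integrable lborel {s..<q} (\<lambda>u. coef u * x (del u))" if "q \<in> T" "s \<le> q" for q
    using X that by auto
  have intf: "set_integrable lborel {s..<q} f" if "q \<in> T" "s \<le> q" for q
  proof -
    have "integrable lborel (\<lambda>u. indicator {u. del u < s} u *\<^sub>R
        (indicator {s..<q} u *\<^sub>R (coef u * x (del u))))"
      by (rule integrable_mult_indicator) (use intx[OF that] in \<open>simp_all only: set_integrable_def, measurable\<close>)
    moreover have "(\<lambda>u. indicator {u. del u < s} u *\<^sub>R (indicator {s..<q} u *\<^sub>R (coef u * x (del u)))) =
        (\<lambda>u. indicator {s..<q} u *\<^sub>R f u)"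
      by (auto simp: f_def indicator_def)
    ultimately show ?thesis by (simp add: set_integrable_def)
  qed
  have Fdiff: "\<bar>F b - F a\<bar> \<le> \<Phi> * (V b - V a)" "V b - V a \<le> B * (b - a)"
    if "s \<le> a" "a \<le> b" "b \<in> T" "b \<le> t" for a b
  proof -
    have "F b - F a = (LINT u:{a..<b}|lborel. f u)"
      using set_integral_Ico_split[OF intf[of b]] that by (simp add: F_def)
    moreover have "\<bar>LINT u:{a..<b}|lborel. f u\<bar> \<le> (LINT u:{a..<b}|lborel. \<Phi> * coef u)"
    proof (rule abs_set_integral_le)
      show "set_integrable lborel {a..<b} f"
        by (rule set_integrable_subset[OF intf[of b]]) (use that in auto)
      show "set_integrable lborel {a..<b} (\<lambda>u. \<Phi> * coef u)"
        using set_integrable_coef by simp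
    qed (use f_le that in auto)
    moreover have V: "V b - V a = (LINT u:{a..<b}|lborel. coef u)"
      using set_integral_Ico_split[OF set_integrable_coef, of s a b] that by (simp add: V_def)
    ultimately show "\<bar>F b - F a\<bar> \<le> \<Phi> * (V b - V a)" by simp
    show "V b - V a \<le> B * (b - a)"
      unfolding V using that B by (intro coef_integral_le) auto
  qed
  have approx: "\<bar>x t\<bar> \<le> \<bar>x0\<bar> * \<bar>fund t s\<bar> + M * (\<Phi> * V m) +
      2 * (\<Phi> * (B * ((m - s) / real (Suc n)))) * exp (2 * B * (t - s))" for n
  proof -
    define h where "h = (m - s) / real (Suc n)"
    have h: "h \<ge> 0" "s + real (Suc n) * h = m" using m by (simp_all add: h_def)
    define r where "r i = Inf (T \<inter> {s + real i * h..})" for i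
    have bdd: "bdd_below (T \<inter> {s + real i * h..})" for i by (rule bdd_belowI[of _ "s + real i * h"]) auto
    have ne: "T \<inter> {s + real i * h..} \<noteq> {}" for i using ex_above[of "s + real i * h"] by force
    have r_in: "r i \<in> T" for i
      unfolding r_def by (rule closed_subset_contains_Inf[OF closed_T _ ne bdd]) auto
    have r_ge: "s + real i * h \<le> r i" for i
      unfolding r_def by (rule cInf_greatest[OF ne]) auto
    have r_le: "r i \<le> \<eta>" if "\<eta> \<in> T" "s + real i * h \<le> \<eta>" for i \<eta>
      unfolding r_def by (rule cInf_lower[OF _ bdd]) (use that in auto)
    have r_mono: "r i \<le> r j" if "i \<le> j" for i j
    proof (rule r_le[OF r_in])
      have "real i * h \<le> real j * h" using that h by (intro mult_right_mono) auto
      then show "s + real i * h \<le> r j" using r_ge[of j] by linarith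
    qed
    have r0: "r 0 = s" using r_le[of s 0] r_ge[of 0] s by simp
    have rn: "r (Suc n) = m" using r_le[of m "Suc n"] r_ge[of "Suc n"] m h by simp
    have r_s: "s \<le> r i" for i using r_mono[of 0 i] r0 by simp
    define c where "c i = F (r (Suc i)) - F (r i)" for i
    \<comment> \<open>The error of the discretised variation of constants formula; the sum is added
      because the forcing has a minus sign. Below \<open>s\<close> it is set to zero, as the initial
      function is already accounted for by \<open>f\<close>.\<close>
    define z where "z q = (if q < s then 0 else
        x q - x0 * fund_ext s q + (\<Sum>i<Suc n. c i * fund_ext (r (Suc i)) q))" for q
    \<comment> \<open>Mass of the forcing up to \<open>q\<close> minus the impulses released by
      then. The error \<open>z\<close> solves the equation with zero history and the perturbation
      \<open>- \<delta>\<close>.\<close>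
    define \<delta> where "\<delta> q = F q - (\<Sum>i<Suc n. c i * (if q < r (Suc i) then 0 else 1))" for q
    have z_del: "coef u * z (del u) = coef u * x (del u) - f u - x0 * (coef u * fund_ext s (del u)) +
        (\<Sum>i<Suc n. c i * (coef u * fund_ext (r (Suc i)) (del u)))" for u
    proof (cases "del u < s")
      case True
      then have "fund_ext s (del u) = 0" "fund_ext (r (Suc i)) (del u) = 0" for i
        using r_s[of "Suc i"] by (auto simp: fund_ext_def)
      then show ?thesis using True by (simp add: z_def f_def)
    qed (simp add: z_def f_def algebra_simps sum_distrib_left)
    have int_z: "set_integrable lborel {s..<q} (\<lambda>u. coef u * z (del u))"
      and z_eq: "z q = - (LINT u:{s..<q}|lborel. coef u * z (del u)) - \<delta> q"
      if q: "q \<in> T" "s \<le> q" for q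
    proof -
      let ?I = "\<lambda>g. LINT u:{s..<q}|lborel. g u"
      note E0 = fund_ext_eq[OF s(1) q(1) s(2) order_refl]
      note E = fund_ext_eq[OF r_in q(1) s(2) r_s]
      have int1: "set_integrable lborel {s..<q} (\<lambda>u. coef u * x (del u) - f u - x0 * (coef u * fund_ext s (del u)))"
        using intx[OF q] intf[OF q] E0(1) by simp
      have int2: "set_integrable lborel {s..<q} (\<lambda>u. \<Sum>i<Suc n. c i * (coef u * fund_ext (r (Suc i)) (del u)))"
        by (intro set_integrable_sum) (use E(1) in auto)
      show "set_integrable lborel {s..<q} (\<lambda>u. coef u * z (del u))"
        unfolding z_del by (rule set_integral_add(1)[OF int1 int2])
      have "?I (\<lambda>u. coef u * z (del u)) = ?I (\<lambda>u. coef u * x (del u)) - F q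
          - x0 * ?I (\<lambda>u. coef u * fund_ext s (del u))
          + ?I (\<lambda>u. \<Sum>i<Suc n. c i * (coef u * fund_ext (r (Suc i)) (del u)))"
        unfolding z_del using intx[OF q] intf[OF q] E0(1) int1 int2
        by (simp only: set_integral_add set_integral_diff set_integrable_mult_right set_integral_mult_right F_def)
      also have "?I (\<lambda>u. \<Sum>i<Suc n. c i * (coef u * fund_ext (r (Suc i)) (del u))) =
          (\<Sum>i<Suc n. c i * ?I (\<lambda>u. coef u * fund_ext (r (Suc i)) (del u)))"
        using E(1) by (subst set_integral_sum) auto
      also have "\<dots> = (\<Sum>i<Suc n. c i * ((if q < r (Suc i) then 0 else 1) - fund_ext (r (Suc i)) q))"
        by (intro sum.cong refl arg_cong2[where f = "(*)"]) (subst E(2), simp)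
      also have "\<dots> = F q - \<delta> q - (\<Sum>i<Suc n. c i * fund_ext (r (Suc i)) q)"
        by (simp add: \<delta>_def right_diff_distrib sum_subtractf)
      finally have "?I (\<lambda>u. coef u * z (del u)) = (x0 - x q) - x0 * (1 - fund_ext s q)
          - \<delta> q - (\<Sum>i<Suc n. c i * fund_ext (r (Suc i)) q)"
        using X q E0(2) by auto
      then show "z q = - ?I (\<lambda>u. coef u * z (del u)) - \<delta> q"
        using q by (simp add: z_def algebra_simps)
    qed
    \<comment> \<open>From \<open>m\<close> on, all impulses have been released and the forcing has
      ended. Before \<open>m\<close>, the discrepancy is the forcing since the last grid point
      \<open>r j\<close> not beyond \<open>q\<close>, at a distance of at most
      \<open>h\<close>.\<close>
    have \<delta>_le: "\<bar>\<delta> q\<bar> \<le> \<Phi> * (B * h)" if q: "q \<in> T" "s \<le> q" "q \<le> t" for q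
    proof (cases "m \<le> q")
      case True
      have "(\<Sum>i<Suc n. c i * (if q < r (Suc i) then 0 else 1)) = (\<Sum>i<Suc n. c i)"
      proof (rule sum.cong)
        fix i assume "i \<in> {..<Suc n}"
        then have "r (Suc i) \<le> q" using True r_mono[of "Suc i" "Suc n"] rn by simp
        then show "c i * (if q < r (Suc i) then 0 else 1) = c i" by simp
      qed simp
      also have "\<dots> = F m - F s"
        using sum_lessThan_telescope[of "\<lambda>i. F (r i)" "Suc n"] by (simp only: c_def r0 rn)
      also have "F s = 0" by (simp add: F_def set_lebesgue_integral_def)
      finally have "\<delta> q = F q - F m" by (simp add: \<delta>_def)
      also have "\<dots> = (LINT u:{m..<q}|lborel. f u)"
        using set_integral_Ico_split[OF intf[OF q(1,2)] m(2) True] by (simp add: F_def)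
      also have "\<dots> = 0"
      proof -
        \<comment> \<open>\<open>late\<close> is silent about \<open>m\<close> itself, which is a
          null set.\<close>
        have "AE u in lborel. u \<noteq> m" by (rule AE_lborel_singleton)
        then have "AE u in lborel. indicator {m..<q} u *\<^sub>R f u = 0"
        proof eventually_elim
          case (elim u)
          then show ?case using late[of u] q by (auto simp: indicator_def f_def)
        qed
        then show ?thesis unfolding set_lebesgue_integral_def by (rule integral_eq_zero_AE)
      qed
      finally show ?thesis using \<Phi> B h by simp
    next
      case False
      define j where "j = (GREATEST i. r i \<le> q)"
      have bnd: "i \<le> n" if "r i \<le> q" for i
        using r_mono[of "Suc n" i] rn False that by (force simp: not_less_eq_eq)
      have "r 0 \<le> q" using r0 q by simp
      from GreatestI_nat[where P = "\<lambda>i. r i \<le> q", OF this bnd]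
      have j: "r j \<le> q" by (simp add: j_def)
      have j_max: "i \<le> j" if "r i \<le> q" for i
        unfolding j_def using that bnd by (rule Greatest_le_nat)
      have iff: "q < r (Suc i) \<longleftrightarrow> \<not> i < j" for i
        using j_max[of "Suc i"] r_mono[of "Suc i" j] j by force
      have "(\<Sum>i<Suc n. c i * (if q < r (Suc i) then 0 else 1)) = (\<Sum>i<j. c i)"
        using bnd[OF j] by (intro sum.mono_neutral_cong_right) (auto simp: iff)
      also have "\<dots> = F (r j) - F s"
        using sum_lessThan_telescope[of "\<lambda>i. F (r i)" j] by (simp only: c_def r0)
      also have "F s = 0" by (simp add: F_def set_lebesgue_integral_def)
      finally have "\<delta> q = F q - F (r j)" by (simp add: \<delta>_def)
      moreover have "q - r j \<le> h"
        using r_le[of q "Suc j"] r_ge[of j] q iff[of j] by (force simp: algebra_simps)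
      ultimately show ?thesis
        using Fdiff[of "r j" q] r_s[of j] j q \<Phi> B
        by (smt (verit) mult_left_mono)
    qed
    have z_t: "\<bar>z t\<bar> \<le> 2 * (\<Phi> * (B * h)) * exp (2 * B * (t - s))"
    proof (rule gronwall[where b = t])
      fix q assume "q \<in> T" "s \<le> q" "q \<le> t"
      then show "\<bar>z q\<bar> \<le> \<Phi> * (B * h) + \<bar>LINT u:{s..<q}|lborel. coef u * z (del u)\<bar>"
        using z_eq[of q] \<delta>_le[of q] by linarith
    qed (use s t m B \<Phi> h int_z in \<open>auto simp: z_def\<close>)
    have "x t = z t + x0 * fund t s - (\<Sum>i<Suc n. c i * fund_ext (r (Suc i)) t)"
      using m by (simp add: z_def fund_ext_def)
    then have "\<bar>x t\<bar> \<le> \<bar>z t\<bar> + \<bar>x0 * fund t s\<bar> + \<bar>\<Sum>i<Suc n. c i * fund_ext (r (Suc i)) t\<bar>"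
      by linarith
    also have "\<bar>\<Sum>i<Suc n. c i * fund_ext (r (Suc i)) t\<bar> \<le>
        (\<Sum>i<Suc n. \<Phi> * (V (r (Suc i)) - V (r i)) * M)"
    proof (rule order_trans[OF sum_abs sum_mono])
      fix i assume "i \<in> {..<Suc n}"
      then have rm: "r (Suc i) \<le> m" using r_mono[of "Suc i" "Suc n"] rn by simp
      then have "\<bar>fund_ext (r (Suc i)) t\<bar> \<le> M"
        using M[of "r (Suc i)"] r_in r_s m by (simp add: fund_ext_def)
      moreover have "\<bar>c i\<bar> \<le> \<Phi> * (V (r (Suc i)) - V (r i))"
        unfolding c_def using rm m r_in r_s r_mono[of i "Suc i"] by (intro Fdiff) auto
      ultimately show "\<bar>c i * fund_ext (r (Suc i)) t\<bar> \<le> \<Phi> * (V (r (Suc i)) - V (r i)) * M"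
        unfolding abs_mult by (intro mult_mono) auto
    qed
    also have "\<dots> = M * (\<Phi> * (\<Sum>i<Suc n. V (r (Suc i)) - V (r i)))"
      by (simp only: sum_distrib_left sum_distrib_right mult_ac)
    also have "(\<Sum>i<Suc n. V (r (Suc i)) - V (r i)) = V m - V s"
      using sum_lessThan_telescope[of "\<lambda>i. V (r i)" "Suc n"] by (simp only: r0 rn)
    also have "V s = 0" by (simp add: V_def set_lebesgue_integral_def)
    finally show ?thesis using z_t by (simp add: abs_mult h_def)
  qed
  let ?R = "\<bar>x0\<bar> * \<bar>fund t s\<bar> + M * (\<Phi> * V m)"
  have "(\<lambda>n. (m - s) / real (Suc n)) \<longlonglongrightarrow> 0"
    using LIMSEQ_Suc[OF lim_const_over_n[of "m - s"]] by simp
  then have "(\<lambda>n. ?R + 2 * (\<Phi> * (B * ((m - s) / real (Suc n)))) * exp (2 * B * (t - s))) \<longlonglongrightarrow>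
      ?R + 2 * (\<Phi> * (B * 0)) * exp (2 * B * (t - s))"
    by (intro tendsto_intros)
  from LIMSEQ_le_const[OF this] approx show ?thesis by (auto simp: V_def)
qed

section \<open>The end of the forcing and the gap after it\<close>

text \<open>As \<alpha> tends to infinity, the set in \<open>delay_inv\<close> is bounded above; it
  contains \<open>s\<close>, and closedness of \<open>T\<close> keeps its supremum in
  \<open>T\<close>.\<close>

lemma delay_inv_props:
  assumes s: "s \<in> T" "t0 \<le> s"
  shows delay_inv_in: "delay_inv T t0 \<alpha> s \<in> T"
    and le_delay_inv_self: "s \<le> delay_inv T t0 \<alpha> s"
    and le_delay_inv: "\<eta> \<in> T \<Longrightarrow> t0 \<le> \<eta> \<Longrightarrow> \<alpha> \<eta> \<le> s \<Longrightarrow> \<eta> \<le> delay_inv T t0 \<alpha> s"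
proof -
  let ?S = "{\<eta> \<in> T \<inter> {t0..}. delay_low T \<alpha> \<eta> \<le> s}"
  obtain N where N: "\<forall>\<eta>\<in>T \<inter> {t0..}. N \<le> \<eta> \<longrightarrow> s + 1 \<le> \<alpha> \<eta>" using \<alpha>_large by blast
  have bdd: "bdd_above ?S"
  proof (rule bdd_aboveI)
    fix \<eta> assume \<eta>: "\<eta> \<in> ?S"
    show "\<eta> \<le> N"
    proof (rule ccontr)
      assume "\<not> \<eta> \<le> N"
      then have "s + 1 \<le> delay_low T \<alpha> \<eta>"
        unfolding delay_low_def using \<eta> N by (intro cINF_greatest) auto
      with \<eta> show False by simp
    qed
  qed
  have mem: "s \<in> ?S" using s delay_low_le_self by simp
  show "delay_inv T t0 \<alpha> s \<in> T"
    unfolding delay_inv_def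
    by (rule closed_subset_contains_Sup[OF closed_T _ _ bdd]) (use mem in auto)
  show "s \<le> delay_inv T t0 \<alpha> s"
    unfolding delay_inv_def by (rule cSup_upper[OF mem bdd])
  assume \<eta>: "\<eta> \<in> T" "t0 \<le> \<eta>" "\<alpha> \<eta> \<le> s"
  then show "\<eta> \<le> delay_inv T t0 \<alpha> s"
    unfolding delay_inv_def using delay_low_le[of \<eta> \<eta>] by (intro cSup_upper[OF _ bdd]) auto
qed

lemma coef_integral_mono:
  assumes "s' \<le> s" "s \<le> t" "t \<le> t'"
  shows "(LINT u:{s..<t}|lborel. coef u) \<le> (LINT u:{s'..<t'}|lborel. coef u)"
proof -
  have nn: "0 \<le> (LINT u:{a..<b}|lborel. coef u)" for a b
    using coef_nonneg by (intro set_integral_nonneg_real)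
  show ?thesis
    using set_integral_Ico_split[OF set_integrable_coef, of s' s t']
      set_integral_Ico_split[OF set_integrable_coef, of s t t'] nn[of s' s] nn[of t t'] assms by simp
qed

lemma del_at_jump:
  "\<tau> \<in> T \<Longrightarrow> t0 \<le> \<tau> \<Longrightarrow> \<tau> \<le> u \<Longrightarrow> u < fwd_jump T \<tau> \<Longrightarrow> del u = \<alpha> \<tau>"
  by (simp add: del_def rho_gap)

text \<open>On [\<tau>, \<sigma>(\<tau>)) \<open>rho\<close> stays at \<tau>, so the delayed factor
  is constant and leaves the integral. The mass at \<tau> thereby becomes readable from values of
  \<open>fund\<close>.\<close>

lemma fund_step:
  assumes \<tau>: "\<tau> \<in> T" and p: "p \<in> T" "t0 \<le> p" "p \<le> \<tau>"
  shows "fund (fwd_jump T \<tau>) p =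
    fund \<tau> p - (LINT u:{\<tau>..<fwd_jump T \<tau>}|lborel. coef u) * fund (\<alpha> \<tau>) p"
proof -
  let ?\<sigma> = "fwd_jump T \<tau>" and ?g = "\<lambda>u. coef u * fund (del u) p"
  note F = fund_sol[OF p(1,2), unfolded sol_iff[OF p(1,2)]]
  have \<sigma>: "?\<sigma> \<in> T" "\<tau> \<le> ?\<sigma>" by (rule fwd_jump_in fwd_jump_ge)+
  then have "(LINT u:{p..<?\<sigma>}|lborel. ?g u) = (LINT u:{p..<\<tau>}|lborel. ?g u) + (LINT u:{\<tau>..<?\<sigma>}|lborel. ?g u)"
    using F p by (intro set_integral_Ico_split) auto
  moreover have "(LINT u:{\<tau>..<?\<sigma>}|lborel. ?g u) = (LINT u:{\<tau>..<?\<sigma>}|lborel. coef u * fund (\<alpha> \<tau>) p)"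
    using \<tau> p del_at_jump[of \<tau>] by (intro set_lebesgue_integral_cong) auto
  ultimately show ?thesis using F \<sigma> \<tau> p by auto
qed

section \<open>The two implications\<close>

lemma stable_imp_fund_bound:
  assumes "uniformly_exponentially_stable T t0 A \<alpha>"
  shows "\<exists>M0>0. \<exists>c0>0. \<forall>s\<in>T \<inter> {t0..}. \<forall>t\<in>T \<inter> {s..}. \<bar>fund t s\<bar> \<le> M0 * decay c0 t s"
proof -
  obtain M c where Mc: "M > 0" "c > 0" and bound:
    "\<And>s x0 \<phi> x t. s \<in> T \<inter> {t0..} \<Longrightarrow> initial_function T \<alpha> s \<phi> \<Longrightarrow> sol s x0 \<phi> x \<Longrightarrow> t \<in> T \<inter> {s..} \<Longrightarrow>
      \<bar>x t\<bar> \<le> M * decay c t s * (\<bar>x0\<bar> + initial_norm T \<alpha> s \<phi>)"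
    using assms unfolding uniformly_exponentially_stable_def by blast
  have "\<bar>fund t s\<bar> \<le> M * decay c t s" if "s \<in> T \<inter> {t0..}" "t \<in> T \<inter> {s..}" for s t
  proof -
    have "initial_function T \<alpha> s (\<lambda>_. 0)"
      by (auto simp: initial_function_def rd_continuous_on_def image_constant_conv)
    moreover have "initial_norm T \<alpha> s (\<lambda>_. 0) = 0"
      by (simp add: initial_norm_def)
    ultimately show ?thesis using bound[OF that(1) _ fund_sol that(2)] that by simp
  qed
  with Mc show ?thesis by blast
qed

lemma fund_bound_imp_stable:
  assumes M0: "M0 > 0" and c: "c > 0"
    and fund: "\<And>s t. s \<in> T \<Longrightarrow> t0 \<le> s \<Longrightarrow> t \<in> T \<Longrightarrow> s \<le> t \<Longrightarrow> \<bar>fund t s\<bar> \<le> M0 * decay c t s"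
    and K: "bdd_above ((\<lambda>s. delta_integral T A s (delay_inv T t0 \<alpha> s)) ` (T \<inter> {t0..}))"
    and D: "bdd_above ((\<lambda>s. delay_inv T t0 \<alpha> s - s) ` (T \<inter> {t0..}))"
  shows "uniformly_exponentially_stable T t0 A \<alpha>"
proof -
  define V where "V s t = (LINT u:{s..<t}|lborel. coef u)" for s t
  define inv where "inv = delay_inv T t0 \<alpha>"
  define \<sigma> where "\<sigma> = fwd_jump T"
  obtain K where K: "V s (inv s) \<le> K" if "s \<in> T" "t0 \<le> s" for s
  proof -
    obtain K where K: "delta_integral T A s (inv s) \<le> K" if "s \<in> T" "t0 \<le> s" for s
      using K by (auto simp: bdd_above_def inv_def)
    have "V s (inv s) = delta_integral T A s (inv s)" if "s \<in> T" "t0 \<le> s" for s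
      using delta_integral_eq[OF that(2,1), of "inv s" A] delay_inv_in[OF that]
        set_integrable_coef[of s "inv s"] by (simp add: V_def inv_def coef_def[abs_def])
    with K show thesis by (intro that[of K]) simp
  qed
  obtain D where D: "inv s - s \<le> D" if "s \<in> T" "t0 \<le> s" for s
    using D by (auto simp: bdd_above_def inv_def)
  have fund_le: "\<bar>fund t s\<bar> \<le> M0" if "s \<in> T" "t0 \<le> s" "t \<in> T" "s \<le> t" for s t
    using fund[OF that] decay_le_1[OF c that(2,1,3)] M0
    by (meson mult_left_le less_imp_le order_trans)
  define K2 where "K2 = max (2 * M0) (V t0 (\<sigma> (inv t0)))"
  \<comment> \<open>With starting point \<open>p = \<alpha> \<tau>\<close> the delayed value is
    \<open>fund p p = 1\<close>, so the mass at \<tau> is a difference of two values of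
    \<open>fund\<close>, each at most \<open>M0\<close> in modulus.\<close>
  have atom: "V \<tau> (\<sigma> \<tau>) \<le> K2" if \<tau>: "\<tau> \<in> T" "t0 \<le> \<tau>" for \<tau>
  proof (cases "t0 \<le> \<alpha> \<tau>")
    case True
    define p where "p = \<alpha> \<tau>"
    have p: "p \<in> T" "t0 \<le> p" "p \<le> \<tau>"
      using True \<alpha>_in \<alpha>_le \<tau> by (auto simp: p_def)
    have "fund p p = 1" using fund_sol[OF p(1,2)] by (simp add: is_solution_def)
    then have "V \<tau> (\<sigma> \<tau>) = fund \<tau> p - fund (\<sigma> \<tau>) p"
      using fund_step[OF \<tau>(1) p] by (simp add: V_def \<sigma>_def p_def)
    also have "\<dots> \<le> 2 * M0"
      using fund_le[OF p(1,2) \<tau>(1) p(3)] fund_le[OF p(1,2), of "\<sigma> \<tau>"] fwd_jump_in fwd_jump_ge[of \<tau>] p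
      by (auto simp: \<sigma>_def)
    finally show ?thesis by (simp add: K2_def)
  next
    \<comment> \<open>No fundamental solution starts at \<open>\<alpha> \<tau>\<close> here. But
      such \<tau> do not exceed \<open>inv t0\<close>, so one fixed bounded interval contains all
      these masses.\<close>
    case False
    then have "\<sigma> \<tau> \<le> \<sigma> (inv t0)"
      using le_delay_inv[OF t0 order_refl \<tau>] monoD[OF mono_fwd_jump] by (auto simp: \<sigma>_def inv_def)
    then show ?thesis
      using coef_integral_mono[of t0 \<tau> "\<sigma> \<tau>" "\<sigma> (inv t0)"] \<tau> fwd_jump_ge[of \<tau>]
      by (simp add: V_def K2_def \<sigma>_def le_max_iff_disj)
  qed
  \<comment> \<open>Lower bound for the decay from \<open>s\<close> to the end \<open>R\<close> of
    the forcing: the exponential covers the stretch up to \<open>inv s\<close>, the factor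
    \<open>1 / max 1 M0\<close> the possible gap after it.\<close>
  define \<kappa> where "\<kappa> = exp (- c * D) / max 1 M0"
  have \<kappa>: "\<kappa> > 0" by (simp add: \<kappa>_def)
  define K' where "K' = max K 0 + K2"
  have K': "K' \<ge> 0" using M0 by (simp add: K'_def K2_def)
  \<comment> \<open>The first term serves the initial value, the second the forcing of total mass at
    most \<open>K'\<close>.\<close>
  define C where "C = M0 + M0 / \<kappa> * K'"
  have C: "C > 0" using M0 \<kappa> K' by (simp add: C_def add_pos_nonneg)
  have "\<bar>x t\<bar> \<le> C * decay c t s * (\<bar>x0\<bar> + initial_norm T \<alpha> s \<phi>)"
    if s: "s \<in> T" "t0 \<le> s" and \<phi>: "initial_function T \<alpha> s \<phi>" and x: "sol s x0 \<phi> x"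
      and t: "t \<in> T" "s \<le> t" for s t x0 \<phi> x
  proof -
    define \<Phi> where "\<Phi> = initial_norm T \<alpha> s \<phi>"
    have bdd: "bdd_above ((\<lambda>q. \<bar>\<phi> q\<bar>) ` initial_interval T \<alpha> s)"
      using \<phi> by (auto simp: initial_function_def bounded_iff bdd_above_def)
    have \<Phi>: "\<bar>\<phi> q\<bar> \<le> \<Phi>" if "q \<in> initial_interval T \<alpha> s" for q
      using cSUP_upper[OF that bdd] that by (auto simp: \<Phi>_def initial_norm_def)
    then have \<Phi>0: "\<Phi> \<ge> 0"
      by (cases "initial_interval T \<alpha> s = {}") (fastforce simp: \<Phi>_def initial_norm_def)+
    define \<tau> where "\<tau> = inv s"
    have \<tau>: "\<tau> \<in> T" "s \<le> \<tau>" "t0 \<le> \<tau>"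
      using delay_inv_in[OF s] le_delay_inv_self[OF s] s by (auto simp: \<tau>_def inv_def)
    \<comment> \<open>The delay at \<open>\<tau>\<close> itself may still reach below \<open>s\<close>.\<close>
    define R where "R = (if \<alpha> \<tau> < s then \<sigma> \<tau> else \<tau>)"
    have \<sigma>: "\<sigma> \<tau> \<in> T" "\<tau> \<le> \<sigma> \<tau>" using fwd_jump_in fwd_jump_ge by (auto simp: \<sigma>_def)
    have R: "R \<in> T" "\<tau> \<le> R" "R \<le> \<sigma> \<tau>" using \<tau> \<sigma> by (auto simp: R_def)
    define m where "m = min t R"
    have m: "m \<in> T" "s \<le> m" "m \<le> t" "m \<le> R" using t R \<tau> by (auto simp: m_def min_def)
    have "V s m \<le> V s (\<sigma> \<tau>)"
      unfolding V_def by (rule coef_integral_mono) (use m R in auto)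
    also have "\<dots> = V s \<tau> + V \<tau> (\<sigma> \<tau>)"
      unfolding V_def using \<tau> \<sigma> by (intro set_integral_Ico_split set_integrable_coef)
    also have "\<dots> \<le> K'" using K[OF s] atom[OF \<tau>(1,3)] by (simp add: \<tau>_def K'_def)
    finally have Vm: "V s m \<le> K'" .
    have \<kappa>_le: "\<kappa> \<le> decay c R s"
    proof -
      have \<tau>s: "exp (- c * D) \<le> decay c \<tau> s"
      proof -
        have "exp (- c * D) \<le> exp (- c * (\<tau> - s))" using D[OF s] c by (simp add: \<tau>_def)
        also have "\<dots> \<le> decay c \<tau> s" using c s \<tau> by (intro decay_ge) auto
        finally show ?thesis .
      qed
      show ?thesis
      proof (cases "\<alpha> \<tau> < s")
        case True
        \<comment> \<open>Started at \<tau>, the fundamental solution reads only its zero history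
          across the gap and keeps the value 1, so its bound limits the decay from \<tau> to
          \<open>\<sigma> \<tau>\<close> from below.\<close>
        then have "\<alpha> \<tau> \<in> initial_interval T \<alpha> \<tau>"
          using \<tau> \<alpha>_in[of \<tau>] delay_low_le[of \<tau> \<tau>] by (auto simp: initial_interval_def)
        then have "fund (\<alpha> \<tau>) \<tau> = 0" "fund \<tau> \<tau> = 1"
          using fund_sol[OF \<tau>(1,3)] by (auto simp: is_solution_def)
        then have "fund (\<sigma> \<tau>) \<tau> = 1" using fund_step[OF \<tau>(1) \<tau>(1) \<tau>(3)] by (simp add: \<sigma>_def)
        then have "1 \<le> M0 * decay c (\<sigma> \<tau>) \<tau>" using fund[OF \<tau>(1,3) \<sigma>] by simp
        then have "1 / max 1 M0 \<le> decay c (\<sigma> \<tau>) \<tau>"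
          using M0 decay_pos[of c "\<sigma> \<tau>" \<tau>]
          by (simp add: divide_le_eq) (smt (verit) mult_left_mono mult.commute)
        then have "1 / max 1 M0 * exp (- c * D) \<le> decay c (\<sigma> \<tau>) \<tau> * decay c \<tau> s"
          using \<tau>s decay_pos by (intro mult_mono) (auto intro: less_imp_le)
        then show ?thesis
          using True decay_split[OF c s(2,1) \<tau>(1) \<sigma>(1) \<tau>(2) \<sigma>(2)] by (simp add: R_def \<kappa>_def)
      next
        case False
        have "\<kappa> \<le> exp (- c * D) / 1" unfolding \<kappa>_def by (intro divide_left_mono) auto
        then show ?thesis using False \<tau>s by (simp add: R_def)
      qed
    qed
    \<comment> \<open>A \<open>u\<close> beyond \<open>R\<close> whose delay falls below
      \<open>s\<close> would round down to \<tau> and lie in the gap after it; but then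
      \<open>R\<close> is the far end of that gap.\<close>
    have late: "s \<le> del u" if "m < u" "u < t" for u
    proof (rule ccontr)
      assume "\<not> s \<le> del u"
      then have less: "\<alpha> (rho u) < s" by (simp add: del_def)
      have u: "R < u" "t0 \<le> u" using that m R \<tau> s by (auto simp: m_def)
      have "rho u \<le> \<tau>"
        using le_delay_inv[OF s rho_in rho_ge_t0, of u] less by (simp add: \<tau>_def inv_def)
      moreover have "\<tau> \<le> rho u" using u R \<tau> by (intro rho_ge) auto
      ultimately have \<tau>u: "rho u = \<tau>" by simp
      then have "u \<notin> T" using rho_eq[of u] u R by auto
      then show False
        using less_fwd_jump_rho(2)[of u] u less by (simp add: \<tau>u R_def \<sigma>_def)
    qed
    \<comment> \<open>An impulse released at \<open>r\<close> has missed the decay from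
      \<open>s\<close> to \<open>r\<close>; this costs at most the factor
      \<open>1 / \<kappa>\<close>.\<close>
    have fund_r: "\<bar>fund t r\<bar> \<le> M0 * (decay c t s / \<kappa>)" if r: "r \<in> T" "s \<le> r" "r \<le> m" for r
    proof -
      have rt: "r \<le> t" "r \<le> R" "t0 \<le> r" using r m s by auto
      have "decay c R s = decay c R r * decay c r s"
        using c s r R rt by (intro decay_split) auto
      also have "\<dots> \<le> 1 * decay c r s"
        using c r R rt decay_pos[of c r s] by (intro mult_right_mono decay_le_1) auto
      finally have "\<kappa> \<le> decay c r s" using \<kappa>_le by simp
      then have "decay c t r * \<kappa> \<le> decay c t r * decay c r s"
        using decay_pos[of c t r] by (intro mult_left_mono) auto
      also have "\<dots> = decay c t s" using c s r t rt by (intro decay_split[symmetric]) auto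
      finally have "decay c t r \<le> decay c t s / \<kappa>" using \<kappa> by (simp add: le_divide_eq)
      then show ?thesis
        using fund[OF r(1) rt(3) t(1) rt(1)] M0 by (smt (verit) mult_left_mono)
    qed
    have "\<bar>x t\<bar> \<le> \<bar>x0\<bar> * \<bar>fund t s\<bar> + M0 * (decay c t s / \<kappa>) * (\<Phi> * V s m)"
      unfolding V_def by (rule solution_bound[OF s x \<Phi>0 \<Phi> t(1) m(1-3) late fund_r])
    also have "\<dots> \<le> \<bar>x0\<bar> * (M0 * decay c t s) + M0 * (decay c t s / \<kappa>) * (\<Phi> * K')"
      using fund[OF s t] Vm \<Phi>0 M0 \<kappa> decay_pos[of c t s]
      by (intro add_mono mult_left_mono) auto
    also have "\<dots> \<le> C * decay c t s * (\<bar>x0\<bar> + \<Phi>)"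
    proof -
      have "0 \<le> M0 * decay c t s * \<Phi>" "0 \<le> M0 / \<kappa> * K' * decay c t s * \<bar>x0\<bar>"
        using M0 \<kappa> K' \<Phi>0 decay_pos[of c t s] by auto
      moreover have "C * decay c t s * (\<bar>x0\<bar> + \<Phi>) =
          \<bar>x0\<bar> * (M0 * decay c t s) + M0 * (decay c t s / \<kappa>) * (\<Phi> * K') +
          (M0 * decay c t s * \<Phi> + M0 / \<kappa> * K' * decay c t s * \<bar>x0\<bar>)"
        by (simp add: C_def algebra_simps add_divide_distrib)
      ultimately show ?thesis by linarith
    qed
    finally show ?thesis by (simp add: \<Phi>_def)
  qed
  then show ?thesis
    unfolding uniformly_exponentially_stable_def using C c by (intro exI[of _ C] conjI exI[of _ c]) auto
qed

end

theorem theorem2p5: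
  fixes T :: "real set" and t0 :: real and A \<alpha> :: "real \<Rightarrow> real"
  assumes "time_scale T" and "\<not> bdd_above T" and "t0 \<in> T"
    and "\<And>t. t \<in> T \<inter> {t0..} \<Longrightarrow> A t \<ge> 0"
    and "rd_continuous_on T (T \<inter> {t0..}) A"
    and "\<And>t. t \<in> T \<inter> {t0..} \<Longrightarrow> \<alpha> t \<in> T"
    and "rd_continuous_on T (T \<inter> {t0..}) \<alpha>"
    and "\<And>t. t \<in> T \<inter> {t0..} \<Longrightarrow> \<alpha> t \<le> t"
    and "filterlim \<alpha> at_top (inf at_top (principal (T \<inter> {t0..})))"
    and "bdd_above ((\<lambda>s. delta_integral T A s (delay_inv T t0 \<alpha> s)) ` (T \<inter> {t0..}))"
    and "bdd_above ((\<lambda>s. delay_inv T t0 \<alpha> s - s) ` (T \<inter> {t0..}))"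
  shows "uniformly_exponentially_stable T t0 A \<alpha> \<longleftrightarrow>
    (\<exists>M0>0. \<exists>c0>0. \<forall>s\<in>T \<inter> {t0..}. \<forall>t\<in>T \<inter> {s..}.
       \<bar>fundamental_solution T A \<alpha> t s\<bar> \<le> M0 * delta_exp T (circle_minus T (\<lambda>_. c0)) t s)"
proof -
  interpret delay_equation T t0 A \<alpha>
    by unfold_locales (use assms in \<open>auto simp: time_scale_def\<close>)
  show ?thesis
    using stable_imp_fund_bound fund_bound_imp_stable[OF _ _ _ assms(10,11)] by fastforce
qed

end
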